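(* Let $S=\bigl((t_1,a_1),\dots,(t_w,a_w)\bigr)$ be a NE-pattern and let $x\in I_S$, $x\ne0$. Then there exist uniquely determined $S$-canonical NE-tableaux $M_i\Gamma_i$, $i=0,\dots,p$, and nonzero coefficients $\lambda_i\in K$ such that $$x=\lambda_0M_0\Gamma_0+\lambda_1M_1\Gamma_1+\dots+\lambda_pM_p\Gamma_p$$ and $$\operatorname{in}(x)=\operatorname{in}(M_0\Gamma_0)>\operatorname{in}(M_1\Gamma_1)>\dots>\operatorname{in}(M_p\Gamma_p).$$
   Context: Let $K$ be a field, $X=(x_{ij})$ an $m\times n$ matrix of indeterminates and $R=K[x_{ij}:1\le i\le m,\ 1\le j\le n]$. Fix the lexicographic monomial order $>$ on $R$ in which $x_{ij}>x_{uv}$ if $i<u$, or $i=u$ and $j<v$; $\operatorname{in}$ denotes the initial monomial. For positive integers $t,a$ with $t\le m$ and $t+a\le n+1$, let $X_t(a)=(x_{ij}:1\le i\le t,\ a\le j\le n)$ and let $I_t(a)\subset R$ be the ideal generated by the $t$-minors of $X_t(a)$. For $c_1<\dots<c_t$ the monomial $\langle c_1\dots c_t\rangle=x_{1c_1}\cdots x_{tc_t}$ is called a diagonal of length $t$; it is the initial monomial of the minor with rows $1,\dots,t$ and columns $c_1,\dots,c_t$. A NE-pattern is a finite sequence $S=\bigl((t_1,a_1),\dots,(t_w,a_w)\bigr)$ of pairs of positive integers with $t_i\le m$ and $t_i+a_i\le n+1$, ordered so that for $i<j$ one has $a_i\le a_j$, and $t_i\ge t_j$ if $a_i=a_j$.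 A pure NE-tableau of pattern $S$ is a product $\Delta=\delta_1\cdots\delta_w$ with $\delta_i$ a $t_i$-minor of $X_{t_i}(a_i)$; a NE-tableau of pattern $S$ is a product $M\Delta$ of a monomial $M$ in the $x_{ij}$ and a pure NE-tableau $\Delta$ of pattern $S$. Set $I_S=I_{t_1}(a_1)\cdots I_{t_w}(a_w)$. A diagonal of type $(t,a)$ in $M\Delta$ is a diagonal $\langle c_1\dots c_t\rangle$ of length $t$ with $c_1\ge a$ that divides $\operatorname{in}(M\Delta)$. A NE-tableau $M\delta_1\cdots\delta_w$ of pattern $S$ is $S$-canonical if for each $j=1,\dots,w$ the monomial $\operatorname{in}(\delta_j)$ is the lexicographically smallest (with respect to $>$) diagonal of type $(t_j,a_j)$ in $M\delta_1\cdots\delta_j$. *)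

theory Defs
  imports
    "HOL-Library.Poly_Mapping"
    "HOL-Library.Product_Lexorder"
    "HOL-Algebra.Ideal_Product"
    "Jordan_Normal_Form.Determinant"
begin

text \<open>
  The indeterminate \<open>x_ij\<close> is indexed by the pair \<open>(i, j)\<close>; rows and columns are numbered from 1.
  A monomial is represented by its exponent vector, so the product of monomials is the sum of
  exponent vectors.
\<close>

type_synonym monomial = "(nat \<times> nat) \<Rightarrow>\<^sub>0 nat"
type_synonym 'k polynomial = "monomial \<Rightarrow>\<^sub>0 'k"

definition monom_poly :: "monomial \<Rightarrow> 'k::field polynomial" where
  "monom_poly u = Poly_Mapping.single u 1"

definition const_poly :: "'k::field \<Rightarrow> 'k polynomial" where
  "const_poly c = Poly_Mapping.single 0 c"

definition var_monomial :: "nat \<times> nat \<Rightarrow> monomial" where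
  "var_monomial v = Poly_Mapping.single v 1"

definition monomials :: "nat \<Rightarrow> nat \<Rightarrow> monomial set" where
  "monomials m n = {u. Poly_Mapping.keys u \<subseteq> {1..m} \<times> {1..n}}"

definition poly_ring :: "nat \<Rightarrow> nat \<Rightarrow> 'k::field polynomial ring" where
  "poly_ring m n =
     \<lparr>carrier = {p. Poly_Mapping.keys p \<subseteq> monomials m n},
      monoid.mult = (*), one = 1, zero = 0, add = (+)\<rparr>"

text \<open>
  The monomial order is the library order on \<open>monomial\<close>: two exponent vectors are compared at the
  smallest index, in the lexicographic order on pairs, at which they differ. Hence indeterminates
  with smaller index are larger, as the two lemmas below spell out.
\<close>

lemma monomial_less_iff:
  fixes u v :: monomial
  shows "u < v \<longleftrightarrow>
    (\<exists>k. Poly_Mapping.lookup u k < Poly_Mapping.lookup v k \<and>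
         (\<forall>k'<k. Poly_Mapping.lookup u k' = Poly_Mapping.lookup v k'))"
  by transfer (auto simp: less_fun_def)

lemma var_monomial_less_iff:
  "var_monomial (u, v) < var_monomial (i, j) \<longleftrightarrow> i < u \<or> i = u \<and> j < v"
proof
  assume "var_monomial (u, v) < var_monomial (i, j)"
  then obtain k where
      "Poly_Mapping.lookup (var_monomial (u, v)) k < Poly_Mapping.lookup (var_monomial (i, j)) k"
    and k: "\<forall>k'<k. Poly_Mapping.lookup (var_monomial (u, v)) k' =
                   Poly_Mapping.lookup (var_monomial (i, j)) k'"
    unfolding monomial_less_iff by blast
  then have *: "k = (i, j)" "k \<noteq> (u, v)"
    by (auto simp: var_monomial_def lookup_single when_def split: if_splits)
  have "\<not> (u, v) < (i, j)"
  proof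
    assume "(u, v) < (i, j)"
    then show False
      using k * by (auto simp: var_monomial_def lookup_single when_def split: if_splits)
  qed
  with * show "i < u \<or> i = u \<and> j < v"
    by auto
next
  assume "i < u \<or> i = u \<and> j < v"
  then show "var_monomial (u, v) < var_monomial (i, j)"
    unfolding monomial_less_iff
    by (intro exI[of _ "(i, j)"]) (auto simp: var_monomial_def lookup_single when_def)
qed

text \<open>Only meaningful for nonzero polynomials.\<close>

definition in_mon :: "'k::field polynomial \<Rightarrow> monomial" where
  "in_mon p = Max (Poly_Mapping.keys p)"

text \<open>
  Column index sets are given by strictly increasing lists. Since \<open>X_t(a)\<close> has exactly \<open>t\<close> rows,
  its \<open>t\<close>-minors involve all rows \<open>1, \<dots>, t\<close>. Entries of \<open>mat\<close> and \<open>!\<close> are numbered from 0.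
\<close>

definition columns :: "nat \<Rightarrow> nat \<Rightarrow> nat \<Rightarrow> nat list set" where
  "columns n t a = {cs. length cs = t \<and> sorted_wrt (<) cs \<and> set cs \<subseteq> {a..n}}"

definition minor :: "nat list \<Rightarrow> 'k::field polynomial" where
  "minor cs = det (mat (length cs) (length cs)
                     (\<lambda>(i, j). monom_poly (var_monomial (Suc i, cs ! j))))"

definition minors :: "nat \<Rightarrow> nat \<Rightarrow> nat \<Rightarrow> 'k::field polynomial set" where
  "minors n t a = minor ` columns n t a"

definition diagonal :: "nat list \<Rightarrow> monomial" where
  "diagonal cs = (\<Sum>k<length cs. var_monomial (Suc k, cs ! k))"

text \<open>In terms of exponent vectors, divisibility of monomials is \<open>\<exists>r. u = d + r\<close>.\<close>

definition diagonals_of_type :: "nat \<Rightarrow> nat \<times> nat \<Rightarrow> monomial \<Rightarrow> monomial set" where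
  "diagonals_of_type n = (\<lambda>(t, a) u. {d \<in> diagonal ` columns n t a. \<exists>r. u = d + r})"

definition ne_pattern :: "nat \<Rightarrow> nat \<Rightarrow> (nat \<times> nat) list \<Rightarrow> bool" where
  "ne_pattern m n S \<longleftrightarrow>
     (\<forall>(t, a)\<in>set S. t \<ge> 1 \<and> a \<ge> 1 \<and> t \<le> m \<and> t + a \<le> n + 1) \<and>
     sorted_wrt (\<lambda>(t, a) (t', a'). a \<le> a' \<and> (a = a' \<longrightarrow> t \<ge> t')) S"

definition ne_ideal :: "nat \<Rightarrow> nat \<Rightarrow> nat \<times> nat \<Rightarrow> 'k::field polynomial set" where
  "ne_ideal m n = (\<lambda>(t, a). genideal (poly_ring m n) (minors n t a))"

text \<open>The empty product of ideals is the unit ideal.\<close>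

definition pattern_ideal :: "nat \<Rightarrow> nat \<Rightarrow> (nat \<times> nat) list \<Rightarrow> 'k::field polynomial set" where
  "pattern_ideal m n S =
     foldr (ideal_prod (poly_ring m n)) (map (ne_ideal m n) S) (carrier (poly_ring m n))"

text \<open>
  A NE-tableau is kept as the pair of its monomial factor and the list of its minors;
  \<open>tab_poly\<close> is the product it stands for.
\<close>

type_synonym 'k tableau = "monomial \<times> 'k polynomial list"

definition tab_poly :: "'k::field tableau \<Rightarrow> 'k polynomial" where
  "tab_poly = (\<lambda>(M, \<delta>s). monom_poly M * prod_list \<delta>s)"

definition ne_tableau :: "nat \<Rightarrow> nat \<Rightarrow> (nat \<times> nat) list \<Rightarrow> 'k::field tableau \<Rightarrow> bool" where
  "ne_tableau m n S = (\<lambda>(M, \<delta>s).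
     M \<in> monomials m n \<and> list_all2 (\<lambda>(t, a) \<delta>. \<delta> \<in> minors n t a) S \<delta>s)"

definition canonical :: "nat \<Rightarrow> nat \<Rightarrow> (nat \<times> nat) list \<Rightarrow> 'k::field tableau \<Rightarrow> bool" where
  "canonical m n S = (\<lambda>(M, \<delta>s).
     ne_tableau m n S (M, \<delta>s) \<and>
     (\<forall>j<length S.
        let D = diagonals_of_type n (S ! j) (in_mon (tab_poly (M, take (Suc j) \<delta>s)))
        in in_mon (\<delta>s ! j) \<in> D \<and> (\<forall>d\<in>D. in_mon (\<delta>s ! j) \<le> d)))"

end

theory Submission
  imports Defs
begin

text \<open>
  The initial monomial of a canonical tableau determines the tableau: its least diagonal of the last
  type belongs to the last minor, and one continues with the rest (\<open>canonical_unique\<close>). Since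
  canonical tableaux with different initial monomials are linearly independent, an expansion is
  unique. It exists as soon as the initial monomial of every nonzero \<open>x \<in> I_S\<close> is the initial monomial of
  a canonical tableau, because one can subtract and descend along the lexicographic order.

  To prove this, initial monomials are characterised by inequalities. A cut is a sequence
  \<open>g 0 < \<dots> < g t\<close> with \<open>n < g t\<close>; its strip consists of the boxes \<open>(r, c)\<close> with \<open>g (r - 1) < c < g r\<close>,
  \<open>1 \<le> r \<le> t\<close>. Every diagonal of length at least \<open>t\<close> to the right of column \<open>g 0\<close> meets the strip. So the
  initial monomial of a tableau of pattern \<open>S\<close> has at least as many factors in the strip as there are
  entries \<open>(t', a)\<close> of \<open>S\<close> with \<open>t \<le> t'\<close> and \<open>g 0 < a\<close>. Two facts turn these inequalities into the
  criterion that is wanted.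

  \<^item> They hold for the initial monomial of every nonzero element of \<open>I_S\<close> (\<open>meets_cuts_in_mon\<close>). To each
    cut belongs a one-parameter family of matrices over the Laurent polynomials. At \<open>\<epsilon> = 0\<close>
    the first \<open>t\<close> rows become dependent in the columns to the right of \<open>g 0\<close>, while every entry
    has the indeterminate \<open>x_rc\<close> as its initial term, with coefficient \<open>\<epsilon>\<close> in the strip and \<open>1\<close>
    elsewhere. Substituting the family into \<open>x\<close> produces a factor \<open>\<epsilon>\<close> for each entry of \<open>S\<close> that is
    counted, whereas the coefficient of the initial monomial is multiplied exactly by \<open>\<epsilon>\<close> to the
    number of its factors in the strip.

  \<^item> They suffice for a canonical tableau (\<open>canonical_tableau_exists\<close>). The lexicographically smallest
    diagonal is the one that lies furthest to the right. It exists, since otherwise a cut of degree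
    \<open>0\<close> appears, and after it has been split off the inequalities for the shorter pattern hold
    (\<open>remove_rightmost\<close>), by an uncrossing argument.
\<close>

section \<open>Initial terms of minors\<close>

text \<open>
  The index type is arbitrary because initial terms are needed both for polynomials and for Laurent
  polynomials, and the coefficient is recorded because it carries a power of a parameter below.
\<close>

definition leading :: "('a::linorder \<Rightarrow>\<^sub>0 'b::comm_ring_1) \<Rightarrow> 'a \<Rightarrow> 'b \<Rightarrow> bool" where
  "leading F u c \<longleftrightarrow>
     (\<exists>G. F = Poly_Mapping.single u c + G \<and> (\<forall>v\<in>Poly_Mapping.keys G. v < u))"

lemma leading_single: "leading (Poly_Mapping.single u c) u c"
  unfolding leading_def by (intro exI[of _ 0]) simp

lemma leading_lookup: "leading F u c \<Longrightarrow> Poly_Mapping.lookup F u = c"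
  unfolding leading_def
  by (auto simp: lookup_add not_in_keys_iff_lookup_eq_zero[symmetric])

lemma leading_keys_le: "leading F u c \<Longrightarrow> v \<in> Poly_Mapping.keys F \<Longrightarrow> v \<le> u"
  unfolding leading_def using keys_add by (fastforce split: if_splits)

lemma leading_add_lower:
  assumes "leading F u c" and "\<And>v. v \<in> Poly_Mapping.keys H \<Longrightarrow> v < u"
  shows "leading (F + H) u c"
proof -
  from assms(1) obtain G where G: "F = Poly_Mapping.single u c + G"
      "\<forall>v\<in>Poly_Mapping.keys G. v < u"
    unfolding leading_def by blast
  have "\<forall>v\<in>Poly_Mapping.keys (G + H). v < u"
    using G(2) assms(2) keys_add[of G H] by blast
  then show ?thesis
    unfolding leading_def G(1) by (intro exI[of _ "G + H"]) (simp add: add.assoc)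
qed

text \<open>
  No cancellation can occur at \<open>u + v\<close>: the order is compatible with addition, so all other products
  of exponents are strictly smaller.
\<close>

lemma leading_mult:
  fixes F G :: "'a::{linorder, ordered_cancel_comm_monoid_add} \<Rightarrow>\<^sub>0 'b::comm_ring_1"
  assumes "leading F u c" and "leading G v d"
  shows "leading (F * G) (u + v) (c * d)"
proof -
  from assms obtain F' G' where
    F: "F = Poly_Mapping.single u c + F'" "\<forall>w\<in>Poly_Mapping.keys F'. w < u" and
    G: "G = Poly_Mapping.single v d + G'" "\<forall>w\<in>Poly_Mapping.keys G'. w < v"
    unfolding leading_def by blast
  have "\<forall>w\<in>Poly_Mapping.keys (Poly_Mapping.single u c * G'). w < u + v"
    using keys_mult[of "Poly_Mapping.single u c" G'] G(2)
    by (fastforce split: if_splits intro: add_strict_left_mono)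
  moreover have "\<forall>w\<in>Poly_Mapping.keys (F' * G). w < u + v"
  proof
    fix w assume "w \<in> Poly_Mapping.keys (F' * G)"
    then obtain a b where "w = a + b" "a \<in> Poly_Mapping.keys F'" "b \<in> Poly_Mapping.keys G"
      using keys_mult[of F' G] by blast
    then show "w < u + v"
      using F(2) leading_keys_le[OF assms(2)] by (auto intro: add_less_le_mono)
  qed
  ultimately have "\<forall>w\<in>Poly_Mapping.keys (Poly_Mapping.single u c * G' + F' * G). w < u + v"
    using keys_add[of "Poly_Mapping.single u c * G'" "F' * G"] by blast
  moreover have "F * G = Poly_Mapping.single (u + v) (c * d)
      + (Poly_Mapping.single u c * G' + F' * G)"
    by (simp add: F(1) G(1) algebra_simps mult_single)
  ultimately show ?thesis
    unfolding leading_def by blast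
qed

lemma leading_unique:
  assumes "leading F u c" "leading F v d" "c \<noteq> 0" "d \<noteq> 0"
  shows "u = v \<and> c = d"
proof -
  have "u \<in> Poly_Mapping.keys F" "v \<in> Poly_Mapping.keys F"
    using assms(3,4) leading_lookup[OF assms(1)] leading_lookup[OF assms(2)]
    by (simp_all add: in_keys_iff)
  then have "u = v"
    using leading_keys_le[OF assms(1)] leading_keys_le[OF assms(2)] by (meson order.antisym)
  then show ?thesis
    using leading_lookup[OF assms(1)] leading_lookup[OF assms(2)] by simp
qed

lemma in_mon_eqI:
  assumes "leading F u c" "c \<noteq> 0"
  shows "in_mon F = u"
  unfolding in_mon_def
proof (rule Max_eqI)
  show "u \<in> Poly_Mapping.keys F"
    using assms(2) leading_lookup[OF assms(1)] by (simp add: in_keys_iff)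
qed (use leading_keys_le[OF assms(1)] in auto)

lemma leading_in_mon:
  assumes "F \<noteq> 0"
  shows "leading F (in_mon F) (Poly_Mapping.lookup F (in_mon F))"
    and "Poly_Mapping.lookup F (in_mon F) \<noteq> 0"
proof -
  let ?u = "in_mon F"
  have ne: "Poly_Mapping.keys F \<noteq> {}"
    using assms by simp
  show "Poly_Mapping.lookup F ?u \<noteq> 0"
    using Max_in[OF finite_keys ne] by (simp add: in_mon_def in_keys_iff)
  have "v < ?u" if "v \<in> Poly_Mapping.keys (F - Poly_Mapping.single ?u (Poly_Mapping.lookup F ?u))" for v
  proof -
    have "v \<noteq> ?u" "v \<in> Poly_Mapping.keys F"
      using that by (auto simp: in_keys_iff lookup_minus lookup_single when_def split: if_splits)
    then show ?thesis
      by (metis in_mon_def Max_ge finite_keys order_neq_le_trans)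
  qed
  then show "leading F ?u (Poly_Mapping.lookup F ?u)"
    unfolding leading_def
    by (intro exI[of _ "F - Poly_Mapping.single ?u (Poly_Mapping.lookup F ?u)"]) auto
qed

lemma lookup_diagonal:
  "Poly_Mapping.lookup (diagonal cs) (r, c) =
     (if 1 \<le> r \<and> r \<le> length cs \<and> cs ! (r - 1) = c then 1 else 0)"
proof -
  have "Poly_Mapping.lookup (diagonal cs) (r, c) =
      (\<Sum>k<length cs. if k = r - 1 then (if 1 \<le> r \<and> cs ! k = c then 1 else 0) else 0)"
    unfolding diagonal_def lookup_sum
    by (rule sum.cong) (cases r; auto simp: var_monomial_def lookup_single when_def)+
  then show ?thesis
    by (cases r) auto
qed

lemma diagonal_inject:
  assumes "length cs = length ds" and "diagonal cs = diagonal ds"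
  shows "cs = ds"
proof (rule nth_equalityI[OF assms(1)])
  fix k assume "k < length cs"
  then have "Poly_Mapping.lookup (diagonal ds) (Suc k, cs ! k) = 1"
    using lookup_diagonal[of cs "Suc k"] assms(2) by simp
  then show "cs ! k = ds ! k"
    by (auto simp: lookup_diagonal split: if_splits)
qed

text \<open>
  The row of the first difference decides, and there the smaller column is the larger
  indeterminate. So moving a diagonal to the right makes it smaller.
\<close>

lemma diagonal_less:
  assumes "length cs = length ds" "j < length cs" "cs ! j < ds ! j"
    and "\<And>k. k < j \<Longrightarrow> cs ! k = ds ! k"
  shows "diagonal ds < diagonal cs"
  unfolding monomial_less_iff
proof (intro exI[of _ "(Suc j, cs ! j)"] conjI allI impI)
  show "Poly_Mapping.lookup (diagonal ds) (Suc j, cs ! j)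
      < Poly_Mapping.lookup (diagonal cs) (Suc j, cs ! j)"
    using assms by (simp add: lookup_diagonal)
  fix k' assume k': "k' < (Suc j, cs ! j)"
  obtain r c where rc: "k' = (r, c)"
    by (cases k')
  have "r \<le> j \<or> r = Suc j \<and> c < cs ! j"
    using k' rc by auto
  then show "Poly_Mapping.lookup (diagonal ds) k' = Poly_Mapping.lookup (diagonal cs) k'"
    using assms by (auto simp: rc lookup_diagonal)
qed

lemma prod_monom_poly:
  "(\<Prod>i\<in>A. monom_poly (f i)) = (monom_poly (\<Sum>i\<in>A. f i) :: 'k::field polynomial)"
  by (induction A rule: infinite_finite_induct)
    (simp_all add: monom_poly_def mult_single)

text \<open>
  The Leibniz formula. A permutation of the columns again gives a product with one factor from each
  row, so each term is a diagonal, with column indices that need not increase.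
\<close>

lemma minor_expansion:
  "minor cs = (\<Sum>p | p permutes {0..<length cs}.
     Poly_Mapping.single (diagonal (map (\<lambda>i. cs ! p i) [0..<length cs])) (signof p) :: 'k::field polynomial)"
proof -
  let ?t = "length cs"
  have "minor cs = (\<Sum>p | p permutes {0..<?t}. signof p *
      (\<Prod>i = 0..<?t. monom_poly (var_monomial (Suc i, cs ! p i)) :: 'k polynomial))"
    unfolding minor_def
    by (subst det_def'[of _ ?t]) (auto intro!: sum.cong prod.cong dest: permutes_in_image)
  also have "\<dots> = (\<Sum>p | p permutes {0..<?t}.
      Poly_Mapping.single (diagonal (map (\<lambda>i. cs ! p i) [0..<?t])) (signof p))"
  proof (rule sum.cong)
    fix p
    let ?u = "diagonal (map (\<lambda>i. cs ! p i) [0..<?t])"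
    have "(\<Prod>i = 0..<?t. monom_poly (var_monomial (Suc i, cs ! p i))) = (monom_poly ?u :: 'k polynomial)"
      unfolding prod_monom_poly diagonal_def
      by (intro arg_cong[where f = monom_poly] sum.cong) auto
    moreover have "signof p * monom_poly ?u = (Poly_Mapping.single ?u (signof p) :: 'k polynomial)"
    proof (cases "sign p = 1")
      case True
      then show ?thesis
        by (simp only: monom_poly_def of_int_1 mult_1_left)
    next
      case False
      then have "sign p = - 1"
        by (simp add: sign_def split: if_splits)
      then show ?thesis
        by (simp only: monom_poly_def of_int_minus of_int_1 mult_minus_left mult_1_left single_uminus)
    qed
    ultimately show "signof p * (\<Prod>i = 0..<?t. monom_poly (var_monomial (Suc i, cs ! p i)))
        = (Poly_Mapping.single ?u (signof p) :: 'k polynomial)"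
      by simp
  qed simp
  finally show ?thesis .
qed

text \<open>
  A permutation other than the identity moves its first non-fixed point to the right, so its term is
  smaller than the diagonal.
\<close>

lemma leading_minor:
  assumes "sorted_wrt (<) cs"
  shows "leading (minor cs :: 'k::field polynomial) (diagonal cs) 1"
proof -
  let ?t = "length cs"
  let ?P = "{p. p permutes {0..<?t}}"
  let ?u = "\<lambda>p. diagonal (map (\<lambda>i. cs ! p i) [0..<?t])"
  let ?term = "\<lambda>p. Poly_Mapping.single (?u p) (signof p) :: 'k polynomial"
  have less: "?u p < diagonal cs" if p: "p permutes {0..<?t}" and "p \<noteq> id" for p
  proof -
    obtain i0 where "p i0 \<noteq> i0"
      using \<open>p \<noteq> id\<close> by (auto simp: fun_eq_iff)
    define i where "i = (LEAST i. p i \<noteq> i)"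
    have i: "p i \<noteq> i" and before: "\<And>k. k < i \<Longrightarrow> p k = k"
      unfolding i_def using LeastI[of "\<lambda>i. p i \<noteq> i", OF \<open>p i0 \<noteq> i0\<close>] not_less_Least by blast+
    have lt: "i < ?t" "p i < ?t"
      using p i permutes_not_in[OF p, of i] permutes_in_image[OF p, of i] by auto
    have "\<not> p i < i"
      using before[of "p i"] i permutes_inj[OF p] by (auto dest: injD)
    then have "i < p i"
      using i by simp
    then have "cs ! i < cs ! p i"
      using assms lt by (simp add: sorted_wrt_nth_less)
    then show ?thesis
      by (intro diagonal_less[of _ _ i]) (use lt before in auto)
  qed
  have "finite ?P" "id \<in> ?P"
    using permutes_id by (simp_all only: finite_permutations finite_atLeastLessThan mem_Collect_eq)
  then have split: "minor cs = ?term id + (\<Sum>p\<in>?P - {id}. ?term p)"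
    unfolding minor_expansion by (rule sum.remove)
  have id: "leading (?term id) (diagonal cs) 1"
    using leading_single[of "diagonal cs" 1] by (simp add: map_nth)
  have lower: "w < diagonal cs" if w: "w \<in> Poly_Mapping.keys (\<Sum>p\<in>?P - {id}. ?term p)" for w
  proof -
    obtain p where p: "p permutes {0..<?t}" "p \<noteq> id" "w \<in> Poly_Mapping.keys (?term p)"
      using w keys_sum[of ?term "?P - {id}"] by blast
    then have "w = ?u p"
      using keys_single[of "?u p" "signof p :: 'k"] by (metis (full_types) empty_iff singletonD)
    then show ?thesis
      using less p by simp
  qed
  show ?thesis
    unfolding split by (rule leading_add_lower[OF id lower])
qed

lemma leading_cancel:
  assumes "leading F u c" "leading G u c" "v \<in> Poly_Mapping.keys (F - G)"
  shows "v < u"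
proof -
  have "Poly_Mapping.lookup F v \<noteq> Poly_Mapping.lookup G v"
    using assms(3) by (simp add: in_keys_iff lookup_minus)
  then have "v \<noteq> u" "v \<in> Poly_Mapping.keys F \<or> v \<in> Poly_Mapping.keys G"
    using leading_lookup[OF assms(1)] leading_lookup[OF assms(2)] by (auto simp: in_keys_iff)
  then show ?thesis
    using leading_keys_le[OF assms(1)] leading_keys_le[OF assms(2)] by (auto simp: order.strict_iff_order)
qed

section \<open>Substitutions into polynomials\<close>

definition eval_monomial :: "('v \<Rightarrow> 'b::comm_ring_1) \<Rightarrow> ('v \<Rightarrow>\<^sub>0 nat) \<Rightarrow> 'b" where
  "eval_monomial h u = (\<Prod>v\<in>Poly_Mapping.keys u. h v ^ Poly_Mapping.lookup u v)"

definition substitute ::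
    "('k::comm_ring_1 \<Rightarrow> 'b::comm_ring_1) \<Rightarrow> ('v \<Rightarrow> 'b) \<Rightarrow> (('v \<Rightarrow>\<^sub>0 nat) \<Rightarrow>\<^sub>0 'k) \<Rightarrow> 'b" where
  "substitute \<iota> h p =
     (\<Sum>u\<in>Poly_Mapping.keys p. \<iota> (Poly_Mapping.lookup p u) * eval_monomial h u)"

lemma eval_monomial_superset:
  assumes "finite A" "Poly_Mapping.keys u \<subseteq> A"
  shows "eval_monomial h u = (\<Prod>v\<in>A. h v ^ Poly_Mapping.lookup u v)"
  unfolding eval_monomial_def
  by (rule prod.mono_neutral_left) (use assms in \<open>auto simp: in_keys_iff\<close>)

lemma eval_monomial_add:
  "eval_monomial h (u + v) = eval_monomial h u * eval_monomial h v"
proof -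
  let ?A = "Poly_Mapping.keys u \<union> Poly_Mapping.keys v"
  have "eval_monomial h (u + v) = (\<Prod>w\<in>?A. h w ^ Poly_Mapping.lookup (u + v) w)"
    by (rule eval_monomial_superset) (auto dest: subsetD[OF keys_add])
  also have "\<dots> = (\<Prod>w\<in>?A. h w ^ Poly_Mapping.lookup u w) * (\<Prod>w\<in>?A. h w ^ Poly_Mapping.lookup v w)"
    by (simp add: lookup_add power_add prod.distrib)
  also have "\<dots> = eval_monomial h u * eval_monomial h v"
    by (simp add: eval_monomial_superset[of ?A])
  finally show ?thesis .
qed

lemma poly_mapping_expand:
  "p = (\<Sum>u\<in>Poly_Mapping.keys p. Poly_Mapping.single u (Poly_Mapping.lookup p u))"
  by (rule poly_mapping_eqI)
    (simp add: lookup_sum lookup_single when_def in_keys_iff)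

lemma substitute_hom:
  assumes "comm_ring_hom \<iota>"
  shows "comm_ring_hom (substitute \<iota> h)"
proof -
  interpret \<iota>: comm_ring_hom \<iota> by fact
  let ?\<phi> = "substitute \<iota> h"
  have superset: "?\<phi> p = (\<Sum>u\<in>A. \<iota> (Poly_Mapping.lookup p u) * eval_monomial h u)"
    if "finite A" "Poly_Mapping.keys p \<subseteq> A" for p A
    unfolding substitute_def
    by (rule sum.mono_neutral_left) (use that in \<open>auto simp: in_keys_iff\<close>)
  have add: "?\<phi> (p + q) = ?\<phi> p + ?\<phi> q" for p q
  proof -
    let ?A = "Poly_Mapping.keys p \<union> Poly_Mapping.keys q"
    have "?\<phi> (p + q) = (\<Sum>u\<in>?A. \<iota> (Poly_Mapping.lookup (p + q) u) * eval_monomial h u)"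
      by (rule superset) (auto dest: subsetD[OF keys_add])
    then show ?thesis
      by (simp add: superset[of ?A] lookup_add \<iota>.hom_add algebra_simps sum.distrib)
  qed
  have zero: "?\<phi> 0 = 0"
    by (simp add: substitute_def)
  have sum: "?\<phi> (\<Sum>i\<in>I. f i) = (\<Sum>i\<in>I. ?\<phi> (f i))" for I :: "'i set" and f
    by (induction I rule: infinite_finite_induct) (auto simp: zero add)
  have single: "?\<phi> (Poly_Mapping.single u a) = \<iota> a * eval_monomial h u" for u a
    by (subst superset[of "{u}"]) auto
  have mult: "?\<phi> (p * q) = ?\<phi> p * ?\<phi> q" for p q
  proof -
    have "p * q = (\<Sum>u\<in>Poly_Mapping.keys p. \<Sum>v\<in>Poly_Mapping.keys q.
        Poly_Mapping.single (u + v) (Poly_Mapping.lookup p u * Poly_Mapping.lookup q v))"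
      by (subst (1) poly_mapping_expand[of p], subst (1) poly_mapping_expand[of q])
        (simp add: sum_product mult_single)
    then have "?\<phi> (p * q) = (\<Sum>u\<in>Poly_Mapping.keys p. \<Sum>v\<in>Poly_Mapping.keys q.
        \<iota> (Poly_Mapping.lookup p u) * eval_monomial h u *
        (\<iota> (Poly_Mapping.lookup q v) * eval_monomial h v))"
      by (simp add: sum single eval_monomial_add \<iota>.hom_mult algebra_simps)
    then show ?thesis
      by (simp add: substitute_def sum_product)
  qed
  have one: "?\<phi> 1 = 1"
    using single[of 0 1] by (simp add: eval_monomial_def)
  show ?thesis
    by unfold_locales (simp_all add: zero one add mult)
qed

lemma substitute_variable:
  assumes "comm_ring_hom \<iota>"
  shows "substitute \<iota> h (monom_poly (var_monomial v)) = h v"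
proof -
  interpret comm_ring_hom \<iota> by fact
  show ?thesis
    by (simp add: substitute_def monom_poly_def var_monomial_def eval_monomial_def)
qed

text \<open>
  Monomials as Laurent monomials; this embedding is compatible with the lexicographic orders.
\<close>

definition int_exponents :: "('v \<Rightarrow>\<^sub>0 nat) \<Rightarrow> 'v \<Rightarrow>\<^sub>0 int" where
  "int_exponents u = (\<Sum>v\<in>Poly_Mapping.keys u. Poly_Mapping.single v (int (Poly_Mapping.lookup u v)))"

lemma lookup_int_exponents:
  "Poly_Mapping.lookup (int_exponents u) v = int (Poly_Mapping.lookup u v)"
  by (simp add: int_exponents_def lookup_sum lookup_single when_def in_keys_iff)

lemma poly_mapping_less_iff:
  fixes u v :: "'a::linorder \<Rightarrow>\<^sub>0 'b::{zero, linorder}"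
  shows "u < v \<longleftrightarrow>
    (\<exists>k. Poly_Mapping.lookup u k < Poly_Mapping.lookup v k \<and>
         (\<forall>k'<k. Poly_Mapping.lookup u k' = Poly_Mapping.lookup v k'))"
  by transfer (auto simp: less_fun_def)

lemma int_exponents_strict_mono: "u < v \<Longrightarrow> int_exponents u < int_exponents v"
  by (simp add: poly_mapping_less_iff lookup_int_exponents)

lemma leading_power:
  assumes "leading F (Poly_Mapping.single v (1::int)) c"
  shows "leading (F ^ k) (Poly_Mapping.single v (int k)) (c ^ k)"
proof (induction k)
  case 0
  then show ?case
    using leading_single[of 0 1] by simp
next
  case (Suc k)
  then show ?case
    using leading_mult[OF assms Suc] by (simp flip: single_add)
qed

lemma leading_prod:
  assumes "\<And>i. i \<in> I \<Longrightarrow> leading (F i) (u i) (c i)"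
  shows "leading (\<Prod>i\<in>I. F i) (\<Sum>i\<in>I. u i :: 'a::{linorder, ordered_cancel_comm_monoid_add}) (\<Prod>i\<in>I. c i)"
  using assms
proof (induction I rule: infinite_finite_induct)
  case (insert i I)
  then show ?case
    by (simp add: leading_mult)
qed (use leading_single[of 0 1] in simp_all)

text \<open>
  Smaller monomials are sent to Laurent polynomials with smaller initial terms, so they do not
  interfere with the image of the initial term. The coefficients \<open>w v\<close> of the substituted entries
  collect in its coefficient.
\<close>

lemma leading_substitute:
  fixes p :: "(('v::linorder) \<Rightarrow>\<^sub>0 nat) \<Rightarrow>\<^sub>0 'k::comm_ring_1"
    and \<iota> :: "'k \<Rightarrow> 'c::comm_ring_1"
  assumes h: "\<And>v. leading (h v) (Poly_Mapping.single v (1::int)) (w v)"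
    and p: "leading p u a" "a \<noteq> 0"
  shows "leading (substitute (\<lambda>a. Poly_Mapping.single 0 (\<iota> a)) h p)
    (int_exponents u) (\<iota> a * eval_monomial w u)"
proof -
  let ?\<iota> = "\<lambda>a. Poly_Mapping.single (0 :: 'v \<Rightarrow>\<^sub>0 int) (\<iota> a)"
  let ?term = "\<lambda>v. ?\<iota> (Poly_Mapping.lookup p v) * eval_monomial h v"
  have "leading (eval_monomial h v) (int_exponents v) (eval_monomial w v)" for v
    unfolding eval_monomial_def int_exponents_def by (intro leading_prod leading_power h)
  then have lead: "leading (?term v) (int_exponents v) (\<iota> (Poly_Mapping.lookup p v) * eval_monomial w v)" for v
    using leading_mult[OF leading_single[of 0]] by fastforce
  have u: "u \<in> Poly_Mapping.keys p"
    using leading_lookup[OF p(1)] p(2) by (simp add: in_keys_iff)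
  have "substitute ?\<iota> h p = ?term u + (\<Sum>v\<in>Poly_Mapping.keys p - {u}. ?term v)"
    unfolding substitute_def by (rule sum.remove) (use u in auto)
  moreover have "w < int_exponents u"
    if w: "w \<in> Poly_Mapping.keys (\<Sum>v\<in>Poly_Mapping.keys p - {u}. ?term v)" for w
  proof -
    obtain v where v: "v \<in> Poly_Mapping.keys p - {u}" "w \<in> Poly_Mapping.keys (?term v)"
      using w keys_sum[of ?term "Poly_Mapping.keys p - {u}"] by blast
    then have "w \<le> int_exponents v"
      using leading_keys_le[OF lead] by blast
    also have "\<dots> < int_exponents u"
      using v leading_keys_le[OF p(1)] by (intro int_exponents_strict_mono) fastforce
    finally show ?thesis .
  qed
  ultimately show ?thesis
    using leading_add_lower[OF lead[of u]] leading_lookup[OF p(1)] by simp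
qed

section \<open>Cuts and the degeneration attached to a cut\<close>

text \<open>
  A cut separates the columns to the right of \<open>g 0\<close>: a diagonal of length at least \<open>t\<close> with
  columns in \<open>{g 0<..n}\<close> starts beyond \<open>g 0\<close> and cannot be beyond \<open>g t\<close> in row \<open>t\<close>, so it enters the
  strip in the first row \<open>r\<close> where its column is below \<open>g r\<close>. Strip degrees therefore bound how many such
  diagonals can be split off from a monomial.
\<close>

definition strip :: "nat \<Rightarrow> (nat \<Rightarrow> nat) \<Rightarrow> (nat \<times> nat) set" where
  "strip t g = {(r, c). 1 \<le> r \<and> r \<le> t \<and> g (r - 1) < c \<and> c < g r}"

definition strip_degree :: "nat \<Rightarrow> (nat \<Rightarrow> nat) \<Rightarrow> monomial \<Rightarrow> nat" where
  "strip_degree t g u = (\<Sum>v\<in>Poly_Mapping.keys u \<inter> strip t g. Poly_Mapping.lookup u v)"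

definition cut :: "nat \<Rightarrow> nat \<Rightarrow> (nat \<Rightarrow> nat) \<Rightarrow> bool" where
  "cut n t g \<longleftrightarrow> t \<ge> 1 \<and> strict_mono_on {..t} g \<and> n < g t"

text \<open>
  Laurent polynomials in the \<open>x_ij\<close> whose coefficients are polynomials in one parameter \<open>\<epsilon>\<close>,
  which is \<open>eps\<close>.
\<close>

type_synonym 'k laurent = "((nat \<times> nat) \<Rightarrow>\<^sub>0 int) \<Rightarrow>\<^sub>0 'k poly"

definition lvar :: "nat \<times> nat \<Rightarrow> 'k::field laurent" where
  "lvar v = Poly_Mapping.single (Poly_Mapping.single v 1) 1"

definition eps :: "'k::field laurent" where
  "eps = Poly_Mapping.single 0 [:0, 1:]"

definition lconst :: "'k::field \<Rightarrow> 'k laurent" where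
  "lconst a = Poly_Mapping.single 0 [:a:]"

text \<open>
  The quotient of the entries in rows \<open>r + 1\<close> and \<open>r\<close> of the pivot column \<open>g r\<close>, and its inverse.
\<close>

definition ratio :: "(nat \<Rightarrow> nat) \<Rightarrow> nat \<Rightarrow> 'k::field laurent" where
  "ratio g r = Poly_Mapping.single (Poly_Mapping.single (Suc r, g r) 1 - Poly_Mapping.single (r, g r) 1) 1"

definition inv_ratio :: "(nat \<Rightarrow> nat) \<Rightarrow> nat \<Rightarrow> 'k::field laurent" where
  "inv_ratio g r = Poly_Mapping.single (Poly_Mapping.single (r, g r) 1 - Poly_Mapping.single (Suc r, g r) 1) 1"

text \<open>
  At \<open>\<epsilon> = 0\<close> and in the columns strictly between \<open>g 0\<close> and \<open>g t\<close>, the first \<open>t\<close> rows of this matrix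
  are a product \<open>L R\<close>, where \<open>L\<close> has \<open>t - 1\<close> columns, \<open>1\<close> in the places \<open>(r, r)\<close>, \<open>ratio g r\<close> in the
  places \<open>(r + 1, r)\<close> and \<open>0\<close> elsewhere; so their rank is less than \<open>t\<close>. In a column \<open>c\<close> the factor \<open>R\<close> has
  \<open>x_rc\<close> in the rows with \<open>g r \<le> c\<close> and \<open>x_(r+1)c / ratio g r\<close> in the others. This choice makes
  every entry outside the strip equal to its indeterminate plus smaller terms. The entries in the
  strip consist of smaller terms only, and the summand with \<open>\<epsilon>\<close> restores their indeterminate.
\<close>

definition degenerate_entry :: "nat \<Rightarrow> (nat \<Rightarrow> nat) \<Rightarrow> nat \<times> nat \<Rightarrow> 'k::field laurent" where
  "degenerate_entry t g = (\<lambda>(r, c).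
     (if (r, c) \<in> strip t g then eps * lvar (r, c) else lvar (r, c)) +
     (if 1 < r \<and> r \<le> t \<and> g (r - 1) < c then ratio g (r - 1) * lvar (r - 1, c) else 0) +
     (if 1 \<le> r \<and> r < t \<and> c < g r then inv_ratio g r * lvar (Suc r, c) else 0))"

lemma lconst_hom: "comm_ring_hom lconst"
  by unfold_locales
    (simp_all add: lconst_def mult_single single_add[symmetric] mult.commute flip: single_one pCons_one)

text \<open>
  The correction terms are Laurent monomials that are smaller than the entry, because
  \<open>x_sc / x_sb < 1\<close> if \<open>b < c\<close> and a higher row outweighs all rows below it.
\<close>

lemma leading_degenerate_entry:
  "leading (degenerate_entry t g v) (Poly_Mapping.single v 1)
     (if v \<in> strip t g then [:0, 1:] else 1 :: 'k::field poly)"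
proof -
  obtain r c where v: "v = (r, c)"
    by (cases v)
  have main: "leading (if v \<in> strip t g then eps * lvar v else lvar v :: 'k laurent)
      (Poly_Mapping.single v 1) (if v \<in> strip t g then [:0, 1:] else 1)"
    by (auto simp: eps_def lvar_def mult_single intro: leading_single)
  have up: "Poly_Mapping.single (Suc s, b) 1 - Poly_Mapping.single (s, b) 1 + Poly_Mapping.single (s, c) 1
      < Poly_Mapping.single (Suc s, c) (1::int)" if "b < c" for s b
    unfolding poly_mapping_less_iff
    by (rule exI[of _ "(s, b)"])
      (use that in \<open>auto simp: lookup_add lookup_minus lookup_single when_def\<close>)
  have down: "Poly_Mapping.single (r, b) 1 - Poly_Mapping.single (Suc r, b) 1 + Poly_Mapping.single (Suc r, c) 1
      < Poly_Mapping.single (r, c) (1::int)" if "c < b" for b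
    unfolding poly_mapping_less_iff
    by (rule exI[of _ "(r, c)"])
      (use that in \<open>auto simp: lookup_add lookup_minus lookup_single when_def\<close>)
  show ?thesis
    unfolding degenerate_entry_def v prod.case
    by (intro leading_add_lower main[unfolded v])
      (use up[of "g (r - 1)" "r - 1"] down[of "g r"] in
        \<open>auto simp: ratio_def inv_ratio_def lvar_def mult_single split: if_splits\<close>)
qed

lemma ratio_inverse: "ratio g r * inv_ratio g r = (1 :: 'k::field laurent)"
  by (simp add: ratio_def inv_ratio_def mult_single)

lemma ratio_pivot: "ratio g r * lvar (r, g r) = (lvar (Suc r, g r) :: 'k::field laurent)"
  by (simp add: ratio_def lvar_def mult_single)

text \<open>
  The linear relation between the rows of \<open>L\<close>, normalised to \<open>1\<close> in row \<open>t\<close>.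
\<close>

definition null_vector :: "nat \<Rightarrow> (nat \<Rightarrow> nat) \<Rightarrow> nat \<Rightarrow> 'k::field laurent" where
  "null_vector t g r = (\<Prod>k = r..<t. - ratio g k)"

lemma null_vector_step:
  "r < t \<Longrightarrow> null_vector t g r = - ratio g r * null_vector t g (Suc r)"
  by (simp add: null_vector_def prod.atLeast_Suc_lessThan)

text \<open>
  The sum telescopes modulo \<open>\<epsilon>\<close>: after each row one monomial is left over, and the next row cancels it.
\<close>

lemma null_vector_relation:
  assumes g: "cut n t g" and c: "g 0 < c" "c < g t"
  shows "eps dvd (\<Sum>r = 1..t. null_vector t g r * degenerate_entry t g (r, c) :: 'k::field laurent)"
proof -
  let ?v = "null_vector t g :: nat \<Rightarrow> 'k laurent"
  let ?h = "degenerate_entry t g :: nat \<times> nat \<Rightarrow> 'k laurent"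
  \<comment> \<open>The partial sum over the rows up to \<open>k\<close>, modulo \<open>\<epsilon>\<close>. At a pivot column both forms would
      serve, by the choice of \<open>ratio\<close>.\<close>
  define rest :: "nat \<Rightarrow> 'k laurent" where
    "rest k = (if k = 0 \<or> k = t then 0
       else if c < g k then ?v k * inv_ratio g k * lvar (Suc k, c) else ?v k * lvar (k, c))" for k
  have step: "eps dvd rest k + ?v (Suc k) * ?h (Suc k, c) - rest (Suc k)" if k: "k < t" for k
  proof -
    have mono: "g k < g (Suc k)"
      using g k by (auto simp: cut_def intro: strict_mono_onD)
    have inv: "?v k * inv_ratio g k = - ?v (Suc k)"
    proof -
      have "?v k * inv_ratio g k = - (ratio g k * inv_ratio g k) * ?v (Suc k)"
        unfolding null_vector_step[OF k] by (simp add: mult_ac)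
      then show ?thesis
        by (simp add: ratio_inverse)
    qed
    have pivot: "?v k * lvar (k, g k) = - (?v (Suc k) * lvar (Suc k, g k))"
    proof -
      have "?v k * lvar (k, g k) = - (?v (Suc k) * (ratio g k * lvar (k, g k)))"
        unfolding null_vector_step[OF k] by (simp add: mult_ac)
      then show ?thesis
        by (simp add: ratio_pivot)
    qed
    have vk: "?v k = - ratio g k * ?v (Suc k)"
      by (rule null_vector_step[OF k])
    consider "k = 0" | "k \<noteq> 0" "c < g k" | "k \<noteq> 0" "c = g k" | "k \<noteq> 0" "g k < c"
      by linarith
    then show ?thesis
    proof cases
      case 1
      then show ?thesis
        using c k mono by (auto simp: rest_def degenerate_entry_def strip_def algebra_simps)
    next
      case 2
      then show ?thesis
        using c k mono inv by (auto simp: rest_def degenerate_entry_def strip_def algebra_simps)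
    next
      case 3
      then show ?thesis
        using c k mono pivot by (auto simp: rest_def degenerate_entry_def strip_def algebra_simps)
    next
      case 4
      then show ?thesis
        using c k mono vk by (auto simp: rest_def degenerate_entry_def strip_def algebra_simps)
    qed
  qed
  have "eps dvd (\<Sum>r = 1..k. ?v r * ?h (r, c)) - rest k" if "k \<le> t" for k
    using that
  proof (induction k)
    case 0
    then show ?case
      by (simp add: rest_def)
  next
    case (Suc k)
    then have "eps dvd ((\<Sum>r = 1..k. ?v r * ?h (r, c)) - rest k)
        + (rest k + ?v (Suc k) * ?h (Suc k, c) - rest (Suc k))"
      using step[of k] by (intro dvd_add) auto
    then show ?case
      by (simp add: algebra_simps)
  qed
  from this[of t] show ?thesis
    by (simp add: rest_def)
qed

text \<open>
  Multiplying the relation between the rows by the adjugate matrix isolates the determinant, since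
  the relation has coefficient \<open>1\<close> in row \<open>t\<close>. This works for longer minors as well: their further rows
  have coefficient \<open>0\<close> in the relation.
\<close>

lemma degenerate_minor:
  assumes g: "cut n t g" and cs: "t \<le> length cs" "set cs \<subseteq> {g 0<..n}"
  shows "eps dvd substitute lconst (degenerate_entry t g) (minor cs :: 'k::field polynomial)"
proof -
  interpret hom: comm_ring_hom "substitute lconst (degenerate_entry t g) :: 'k polynomial \<Rightarrow> 'k laurent"
    by (rule substitute_hom[OF lconst_hom])
  let ?\<phi> = "substitute lconst (degenerate_entry t g) :: 'k polynomial \<Rightarrow> 'k laurent"
  let ?N = "length cs"
  define A :: "'k laurent mat" where
    "A = mat ?N ?N (\<lambda>(i, j). degenerate_entry t g (Suc i, cs ! j))"
  have A: "A \<in> carrier_mat ?N ?N"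
    by (simp add: A_def)
  have "?\<phi> (minor cs) = det (map_mat ?\<phi> (mat ?N ?N (\<lambda>(i, j). monom_poly (var_monomial (Suc i, cs ! j)))))"
    unfolding minor_def by (rule hom.hom_det[symmetric])
  also have "map_mat ?\<phi> (mat ?N ?N (\<lambda>(i, j). monom_poly (var_monomial (Suc i, cs ! j)))) = A"
    unfolding A_def by (rule eq_matI) (auto simp: substitute_variable[OF lconst_hom])
  finally have det: "?\<phi> (minor cs) = det A" .
  have t: "1 \<le> t"
    using g by (simp add: cut_def)
  let ?B = "adj_mat A"
  have AB: "(\<Sum>j<?N. A $$ (i, j) * ?B $$ (j, t - 1)) = (if i = t - 1 then det A else 0)" if "i < t" for i
  proof -
    have "(A * ?B) $$ (i, t - 1) = (\<Sum>j<?N. A $$ (i, j) * ?B $$ (j, t - 1))"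
      using A adj_mat(1)[OF A] that cs(1) t
      by (simp add: scalar_prod_def atLeast0LessThan)
    then show ?thesis
      using adj_mat(2)[OF A] that cs(1) t by (cases "i = t - 1") auto
  qed
  have "det A = (\<Sum>i<t. null_vector t g (Suc i) * (if i = t - 1 then det A else 0))"
    using t by (simp add: null_vector_def if_distrib[of "(*) _"] cong: if_cong)
  also have "\<dots> = (\<Sum>i<t. null_vector t g (Suc i) * (\<Sum>j<?N. A $$ (i, j) * ?B $$ (j, t - 1)))"
    by (rule sum.cong) (simp_all only: lessThan_iff AB)
  also have "\<dots> = (\<Sum>j<?N. (\<Sum>i<t. null_vector t g (Suc i) * A $$ (i, j)) * ?B $$ (j, t - 1))"
    unfolding sum_distrib_left sum_distrib_right mult.assoc by (rule sum.swap)
  also have "eps dvd \<dots>"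
  proof (rule dvd_sum, rule dvd_mult2)
    fix j assume "j \<in> {..<?N}"
    then have j: "j < ?N"
      by simp
    then have "cs ! j \<in> {g 0<..n}"
      using cs(2) nth_mem by blast
    then have c: "g 0 < cs ! j" "cs ! j < g t"
      using g by (auto simp: cut_def)
    have "(\<Sum>i<t. null_vector t g (Suc i) * A $$ (i, j))
        = (\<Sum>r = 1..t. null_vector t g r * degenerate_entry t g (r, cs ! j))"
      by (rule sum.reindex_bij_witness[of _ "\<lambda>r. r - 1" Suc]) (use j cs(1) in \<open>auto simp: A_def\<close>)
    then show "eps dvd (\<Sum>i<t. null_vector t g (Suc i) * A $$ (i, j))"
      using null_vector_relation[OF g c] by simp
  qed
  finally show ?thesis
    unfolding det .
qed

lemma eval_strip_weights:
  "eval_monomial (\<lambda>v. if v \<in> strip t g then \<epsilon> else 1) u = \<epsilon> ^ strip_degree t g u"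
proof -
  have "eval_monomial (\<lambda>v. if v \<in> strip t g then \<epsilon> else 1) u
      = (\<Prod>v\<in>Poly_Mapping.keys u. if v \<in> strip t g then \<epsilon> ^ Poly_Mapping.lookup u v else 1)"
    unfolding eval_monomial_def by (rule prod.cong) auto
  also have "\<dots> = (\<Prod>v\<in>Poly_Mapping.keys u \<inter> strip t g. \<epsilon> ^ Poly_Mapping.lookup u v)"
    by (simp add: prod.If_cases Collect_mem_eq)
  finally show ?thesis
    by (simp add: strip_degree_def power_sum)
qed

text \<open>
  The degeneration multiplies the coefficient of the initial monomial by \<open>\<epsilon>\<close> once for each factor
  in the strip and by nothing else, so divisibility by a power of \<open>\<epsilon>\<close> is visible in the initial monomial.
\<close>

lemma strip_degree_in_mon_ge:
  fixes x :: "'k::field polynomial"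
  assumes "x \<noteq> 0" and dvd: "eps ^ e dvd substitute lconst (degenerate_entry t g) x"
  shows "e \<le> strip_degree t g (in_mon x)"
proof -
  let ?a = "Poly_Mapping.lookup x (in_mon x)" and ?d = "strip_degree t g (in_mon x)"
  let ?U = "int_exponents (in_mon x)"
  have "leading (substitute lconst (degenerate_entry t g) x) ?U
      ([:?a:] * eval_monomial (\<lambda>v. if v \<in> strip t g then [:0, 1:] else 1) (in_mon x))"
    unfolding lconst_def
    by (rule leading_substitute[OF leading_degenerate_entry leading_in_mon[OF assms(1)]])
  then have coeff: "Poly_Mapping.lookup (substitute lconst (degenerate_entry t g) x) ?U = smult ?a ([:0, 1:] ^ ?d)"
    by (simp add: leading_lookup eval_strip_weights)
  obtain G where G: "substitute lconst (degenerate_entry t g) x = eps ^ e * G"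
    using dvd by (elim dvdE)
  have eps_power: "eps ^ e = (Poly_Mapping.single 0 ([:0, 1:] ^ e) :: 'k laurent)"
    by (induction e) (simp_all add: eps_def mult_single)
  have "Poly_Mapping.lookup (eps ^ e * G) ?U = [:0, 1:] ^ e * Poly_Mapping.lookup G ?U"
    unfolding eps_power mult_map_scale_conv_mult[symmetric]
    by (simp add: Poly_Mapping.map.rep_eq when_def)
  then have "[:0, 1:] ^ e dvd smult ?a ([:0, 1:] ^ ?d)"
    using coeff G by (metis dvd_triv_left)
  then have "[:0, 1:] ^ e dvd ([:0, 1:] ^ ?d :: 'k poly)"
    using leading_in_mon(2)[OF assms(1)] dvd_smult_cancel by blast
  then have "degree ([:0, 1:] ^ e :: 'k poly) \<le> degree ([:0, 1:] ^ ?d :: 'k poly)"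
    by (rule dvd_imp_degree_le) simp
  then show ?thesis
    by (simp add: degree_linear_power)
qed

section \<open>Splitting off the rightmost diagonal\<close>

lemma strip_degree_superset:
  assumes "finite A" "Poly_Mapping.keys u \<subseteq> A"
  shows "strip_degree t g u = (\<Sum>v\<in>A \<inter> strip t g. Poly_Mapping.lookup u v)"
  unfolding strip_degree_def
  by (rule sum.mono_neutral_left) (use assms in \<open>auto simp: in_keys_iff\<close>)

lemma strip_degree_add: "strip_degree t g (u + v) = strip_degree t g u + strip_degree t g v"
proof -
  let ?A = "Poly_Mapping.keys u \<union> Poly_Mapping.keys v"
  have "strip_degree t g (u + v) = (\<Sum>w\<in>?A \<inter> strip t g. Poly_Mapping.lookup (u + v) w)"
    by (rule strip_degree_superset) (auto dest: subsetD[OF keys_add])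
  then show ?thesis
    by (simp add: strip_degree_superset[of ?A] lookup_add sum.distrib)
qed

lemma strip_degree_le:
  assumes "\<And>v. v \<in> strip t g \<Longrightarrow> 0 < Poly_Mapping.lookup u v \<Longrightarrow> v \<in> strip t' g'"
  shows "strip_degree t g u \<le> strip_degree t' g' u"
  unfolding strip_degree_def
  by (rule sum_mono2) (use assms in \<open>auto simp: in_keys_iff\<close>)

lemma diagonal_divides_iff:
  "(\<exists>v. u = diagonal cs + v) \<longleftrightarrow> (\<forall>k<length cs. 0 < Poly_Mapping.lookup u (Suc k, cs ! k))"
proof
  assume "\<exists>v. u = diagonal cs + v"
  then show "\<forall>k<length cs. 0 < Poly_Mapping.lookup u (Suc k, cs ! k)"
    by (auto simp: lookup_add lookup_diagonal)
next
  assume pos: "\<forall>k<length cs. 0 < Poly_Mapping.lookup u (Suc k, cs ! k)"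
  have "Poly_Mapping.lookup (diagonal cs) v \<le> Poly_Mapping.lookup u v" for v
  proof (cases v)
    case (Pair r c)
    then show ?thesis
      using pos[rule_format, of "r - 1"] by (cases r) (auto simp: lookup_diagonal Suc_le_eq)
  qed
  then have "u = diagonal cs + (u - diagonal cs)"
    by (intro poly_mapping_eqI) (simp add: lookup_add minus_poly_mapping.rep_eq)
  then show "\<exists>v. u = diagonal cs + v" ..
qed

text \<open>
  If \<open>g\<close> is a cut of length \<open>t\<close> with \<open>b = g 0\<close>, then all diagonals of the types counted here meet its
  strip.
\<close>

definition pattern_count :: "(nat \<times> nat) list \<Rightarrow> nat \<Rightarrow> nat \<Rightarrow> nat" where
  "pattern_count S t b = length (filter (\<lambda>(t', a). t \<le> t' \<and> b < a) S)"

definition meets_cuts :: "nat \<Rightarrow> (nat \<times> nat) list \<Rightarrow> monomial \<Rightarrow> bool" where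
  "meets_cuts n S u \<longleftrightarrow> (\<forall>t g. cut n t g \<longrightarrow> pattern_count S t (g 0) \<le> strip_degree t g u)"

text \<open>
  The greedy diagonal, chosen from row \<open>t\<close> upwards: \<open>d r\<close> is the last column before \<open>d (r + 1)\<close> such
  that \<open>u\<close> involves \<open>x_rc\<close>. The end value \<open>d (t + 1) = n + 1\<close> stands for no restriction in row \<open>t\<close>, and
  makes \<open>r \<mapsto> d (r + 1)\<close> a cut whose strip is free of \<open>u\<close>.
\<close>

definition rightmost :: "nat \<Rightarrow> nat \<Rightarrow> (nat \<Rightarrow> nat) \<Rightarrow> monomial \<Rightarrow> bool" where
  "rightmost n t d u \<longleftrightarrow> strict_mono_on {1..Suc t} d \<and> d (Suc t) = Suc n \<and>
     (\<forall>r\<in>{1..t}. 0 < Poly_Mapping.lookup u (r, d r) \<and>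
        (\<forall>c. d r < c \<and> c < d (Suc r) \<longrightarrow> Poly_Mapping.lookup u (r, c) = 0))"

abbreviation row_list :: "nat \<Rightarrow> (nat \<Rightarrow> nat) \<Rightarrow> nat list" where
  "row_list t d \<equiv> map d [Suc 0..<Suc t]"

lemma lookup_diagonal_row_list:
  "Poly_Mapping.lookup (diagonal (row_list t d)) (r, c) =
    (if 1 \<le> r \<and> r \<le> t \<and> d r = c then 1 else 0)"
  by (auto simp: lookup_diagonal simp del: upt_Suc)

text \<open>
  If the greedy choice gets stuck in row \<open>j\<close>, then the part of the diagonal found so far is a cut from
  row \<open>j\<close> on. Continued above with unit steps, whose strips are empty, it becomes a cut of
  degree \<open>0\<close>.
\<close>

lemma exists_rightmost:
  assumes a: "1 \<le> a" "1 \<le> t" "t + a \<le> n + 1"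
    and pos: "\<And>g. cut n t g \<Longrightarrow> g 0 < a \<Longrightarrow> 0 < strip_degree t g u"
  obtains d where "rightmost n t d u" and "a \<le> d 1"
proof -
  \<comment> \<open>The diagonal from row \<open>j\<close> on; its start leaves room for \<open>j - 1\<close> smaller columns from \<open>a\<close> on.\<close>
  define Q where "Q j d \<longleftrightarrow> strict_mono_on {j..Suc t} d \<and> d (Suc t) = Suc n \<and> a + j \<le> Suc (d j) \<and>
     (\<forall>r\<in>{j..t}. 0 < Poly_Mapping.lookup u (r, d r) \<and>
        (\<forall>c. d r < c \<and> c < d (Suc r) \<longrightarrow> Poly_Mapping.lookup u (r, c) = 0))" for j and d :: "nat \<Rightarrow> nat"
  have "\<exists>d. Q 1 d"
  proof (rule inc_induct[of 1 "Suc t"])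
    show "\<exists>d. Q (Suc t) d"
      by (rule exI[of _ "\<lambda>_. Suc n"]) (use a in \<open>auto simp: Q_def intro: strict_mono_onI\<close>)
  next
    fix j assume j: "1 \<le> j" "j < Suc t" and "\<exists>d. Q (Suc j) d"
    then obtain d where d: "strict_mono_on {Suc j..Suc t} d" "d (Suc t) = Suc n" "a + Suc j \<le> Suc (d (Suc j))"
      and row: "\<And>r. Suc j \<le> r \<Longrightarrow> r \<le> t \<Longrightarrow> 0 < Poly_Mapping.lookup u (r, d r)"
      and gap: "\<And>r c. Suc j \<le> r \<Longrightarrow> r \<le> t \<Longrightarrow> d r < c \<Longrightarrow> c < d (Suc r) \<Longrightarrow> Poly_Mapping.lookup u (r, c) = 0"
      unfolding Q_def by auto
    have d_less: "d x < d y" if "Suc j \<le> x" "x < y" "y \<le> Suc t" for x y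
      using strict_mono_onD[OF d(1), of x y] that by auto
    define C where "C = {c. a + j \<le> Suc c \<and> c < d (Suc j) \<and> 0 < Poly_Mapping.lookup u (j, c)}"
    have "finite C"
      unfolding C_def by simp
    have "C \<noteq> {}"
    proof
      assume C: "C = {}"
      define g where "g k = (if k < j then a - 1 + k else d (Suc k))" for k
      have "g x < g y" if xy: "x < y" "y \<le> t" for x y
      proof (cases "y < j \<or> j \<le> x")
        case True
        then show ?thesis
          using xy d_less[of "Suc x" "Suc y"] by (auto simp: g_def)
      next
        case False
        then have "a - 1 + x < d (Suc j)"
          using d(3) a(1) by linarith
        also have "d (Suc j) \<le> d (Suc y)"
          using False xy d_less[of "Suc j" "Suc y"] by (cases "j = y") auto
        finally have "a - 1 + x < d (Suc y)" .
        then show ?thesis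
          using False by (simp add: g_def)
      qed
      then have "cut n t g"
        unfolding cut_def using a(2) j d(2) by (auto intro!: strict_mono_onI simp: g_def)
      moreover have "g 0 < a"
        using a(1) j by (simp add: g_def)
      moreover have "Poly_Mapping.lookup u (r, c) = 0" if rc: "(r, c) \<in> strip t g" for r c
      proof -
        have r: "1 \<le> r" "r \<le> t" "g (r - 1) < c" "c < g r"
          using rc by (auto simp: strip_def)
        consider "r < j" | "r = j" | "j < r"
          by linarith
        then show ?thesis
        proof cases
          case 1
          then have "r - 1 < j"
            by linarith
          then have "a - 1 + (r - 1) < c" "c < a - 1 + r"
            using r 1 by (simp_all add: g_def)
          then show ?thesis
            by linarith
        next
          case 2
          then have "a + j \<le> Suc c" "c < d (Suc j)"
            using r a(1) by (auto simp: g_def)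
          then show ?thesis
            using C 2 by (auto simp: C_def)
        next
          case 3
          then have "\<not> r - 1 < j" "Suc (r - 1) = r"
            by linarith+
          then show ?thesis
            using r gap[of r c] 3 by (auto simp: g_def)
        qed
      qed
      then have "strip_degree t g u = 0"
        unfolding strip_degree_def by (intro sum.neutral) auto
      ultimately show False
        using pos by fastforce
    qed
    have max: "Max C \<in> C" "\<And>c. c \<in> C \<Longrightarrow> c \<le> Max C"
      using \<open>finite C\<close> \<open>C \<noteq> {}\<close> by auto
    let ?d = "d(j := Max C)"
    have mono: "?d x < ?d y" if "j \<le> x" "x < y" "y \<le> Suc t" for x y
      using that d_less[of x y] d_less[of "Suc j" y] max(1)
      by (cases "y = Suc j") (auto simp: C_def)
    have gap_j: "Poly_Mapping.lookup u (j, c) = 0" if "Max C < c" "c < d (Suc j)" for c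
    proof (rule ccontr)
      assume "Poly_Mapping.lookup u (j, c) \<noteq> 0"
      moreover have "a + j \<le> Suc (Max C)"
        using max(1) by (simp add: C_def)
      ultimately have "c \<in> C"
        using that unfolding C_def by simp
      then show False
        using max(2) that(1) by fastforce
    qed
    have "Q j ?d"
      unfolding Q_def
    proof (intro conjI ballI allI impI)
      show "strict_mono_on {j..Suc t} ?d"
        by (rule strict_mono_onI) (rule mono, auto)
      show "?d (Suc t) = Suc n" "a + j \<le> Suc (?d j)"
        using d(2) j max(1) by (simp_all add: C_def)
      fix r assume r: "r \<in> {j..t}"
      show "0 < Poly_Mapping.lookup u (r, ?d r)"
        using row[of r] r max(1) by (cases "r = j") (simp_all add: C_def)
      fix c assume "?d r < c \<and> c < ?d (Suc r)"
      then show "Poly_Mapping.lookup u (r, c) = 0"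
        using gap[of r c] gap_j[of c] r by (cases "r = j") simp_all
    qed
    then show "\<exists>d. Q j d"
      by blast
  qed simp
  then obtain d where "Q 1 d" ..
  then have "rightmost n t d u" "a \<le> d 1"
    by (auto simp: Q_def rightmost_def)
  then show thesis
    by (rule that)
qed

text \<open>
  Every diagonal that divides \<open>u\<close> lies weakly to the left of the greedy one in each row, by induction
  from row \<open>t\<close> upwards; and a diagonal further to the left is larger.
\<close>

lemma rightmost_least:
  assumes d: "rightmost n t d u" and cs: "cs \<in> columns n t a"
    and dvd: "\<exists>v. u = diagonal cs + v"
  shows "diagonal (row_list t d) \<le> diagonal cs"
proof (cases "cs = row_list t d")
  case False
  have len: "length cs = t" and set: "set cs \<subseteq> {a..n}"
    and less: "\<And>i j. i < j \<Longrightarrow> j < t \<Longrightarrow> cs ! i < cs ! j"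
    using cs by (auto simp: columns_def sorted_wrt_nth_less)
  have pos: "0 < Poly_Mapping.lookup u (Suc k, cs ! k)" if "k < t" for k
    using dvd that len unfolding diagonal_divides_iff by blast
  have le: "cs ! k \<le> d (Suc k)" if "k < t" for k
  proof -
    have "k < t \<longrightarrow> cs ! k \<le> d (Suc k)"
    proof (rule inc_induct[of k t])
      fix j assume j: "k \<le> j" "j < t" and IH: "Suc j < t \<longrightarrow> cs ! Suc j \<le> d (Suc (Suc j))"
      have "cs ! j < d (Suc (Suc j))"
      proof (cases "Suc j < t")
        case True
        then show ?thesis
          using IH less[of j "Suc j"] by simp
      next
        case False
        then have "Suc j = t"
          using j by simp
        then have "d (Suc (Suc j)) = Suc n"
          using d by (simp add: rightmost_def)
        moreover have "cs ! j \<le> n"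
          using j set len nth_mem[of j cs] by (meson atLeastAtMost_iff subsetD)
        ultimately show ?thesis
          by simp
      qed
      moreover have "\<not> (d (Suc j) < cs ! j \<and> cs ! j < d (Suc (Suc j)))"
        using d pos[of j] j by (auto simp: rightmost_def)
      ultimately show "j < t \<longrightarrow> cs ! j \<le> d (Suc j)"
        by linarith
    qed (use that in auto)
    then show ?thesis
      using that by blast
  qed
  have differ: "\<exists>k. k < t \<and> cs ! k \<noteq> d (Suc k)"
    using False len by (auto simp: list_eq_iff_nth_eq simp del: upt_Suc)
  define j where "j = (LEAST k. k < t \<and> cs ! k \<noteq> d (Suc k))"
  have j: "j < t" "cs ! j \<noteq> d (Suc j)"
    using LeastI_ex[OF differ] unfolding j_def by simp_all
  have before: "cs ! k = d (Suc k)" if "k < j" for k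
    using not_less_Least[of k "\<lambda>k. k < t \<and> cs ! k \<noteq> d (Suc k)"] that j(1)
    by (simp add: j_def)
  have "diagonal (row_list t d) < diagonal cs"
    by (rule diagonal_less[of _ _ j])
      (use j len le[of j] before in \<open>auto simp: order.strict_iff_order simp del: upt_Suc\<close>)
  then show ?thesis
    by simp
qed simp

text \<open>
  Splitting off the greedy diagonal may lower the strip degree of a cut \<open>g\<close> by more than the
  pattern allows, if the diagonal meets the strip several times or if \<open>g\<close> has more than \<open>t\<close> rows. In this
  case \<open>g\<close> is replaced, from the first row \<open>q\<close> on in which the diagonal meets the strip, by its maximum
  with the cut \<open>r \<mapsto> d (r + 1)\<close>, and is ended after row \<open>t\<close>. The strip of the latter is free of \<open>u\<close>, so the
  degree does not grow, and the diagonal meets the new strip only in row \<open>q\<close>. The condition for the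
  new cut and \<open>u\<close> then gives the condition for \<open>g\<close> and \<open>v\<close>. The assumption on \<open>S\<close> makes
  sure that the last entry of the pattern is counted for the new cut whenever an earlier one is.
\<close>

lemma remove_rightmost:
  assumes S: "\<And>t' a'. (t', a') \<in> set S \<Longrightarrow> a' \<le> a"
    and cuts: "meets_cuts n (S @ [(t, a)]) u"
    and t: "1 \<le> t" and d: "rightmost n t d u"
    and u: "u = diagonal (row_list t d) + v"
  shows "meets_cuts n S v"
  unfolding meets_cuts_def
proof (intro allI impI)
  fix s g assume g: "cut n s g"
  let ?D = "diagonal (row_list t d)"
  have d_less: "d x < d y" if "1 \<le> x" "x < y" "y \<le> Suc t" for x y
    using d strict_mono_onD[of "{1..Suc t}" d x y] that by (auto simp: rightmost_def)
  have g_less: "g x < g y" if "x < y" "y \<le> s" for x y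
    using g strict_mono_onD[of "{..s}" g x y] that by (auto simp: cut_def)
  have D: "1 \<le> r \<and> r \<le> t \<and> c = d r" if "(r, c) \<in> Poly_Mapping.keys ?D" for r c
    using that by (auto simp: in_keys_iff lookup_diagonal_row_list simp del: upt_Suc split: if_splits)
  show "pattern_count S s (g 0) \<le> strip_degree s g v"
  proof (cases "\<exists>r. 1 \<le> r \<and> r \<le> t \<and> (r, d r) \<in> strip s g")
    case False
    have "strip_degree s g ?D = 0"
    proof -
      have "Poly_Mapping.keys ?D \<inter> strip s g = {}"
        using False by (auto dest!: D simp del: upt_Suc)
      then show ?thesis
        by (simp add: strip_degree_def del: upt_Suc)
    qed
    moreover have "pattern_count S s (g 0) \<le> pattern_count (S @ [(t, a)]) s (g 0)"
      by (simp add: pattern_count_def)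
    moreover have "pattern_count (S @ [(t, a)]) s (g 0) \<le> strip_degree s g u"
      using cuts g by (simp add: meets_cuts_def)
    ultimately show ?thesis
      by (simp add: u strip_degree_add)
  next
    case True
    define q where "q = (LEAST r. 1 \<le> r \<and> r \<le> t \<and> (r, d r) \<in> strip s g)"
    have q: "1 \<le> q" "q \<le> t" "(q, d q) \<in> strip s g"
      using LeastI_ex[OF True] unfolding q_def by simp_all
    have first: "(r, d r) \<notin> strip s g" if "r < q" "1 \<le> r" for r
      using not_less_Least[of r "\<lambda>r. 1 \<le> r \<and> r \<le> t \<and> (r, d r) \<in> strip s g"] that q(2)
      by (simp add: q_def)
    define s' where "s' = min s t"
    define g' where "g' k = (if k < q then g k else max (g k) (d (Suc k)))" for k
    have qs: "q \<le> s'" "s' \<le> s" "s' \<le> t"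
      using q by (auto simp: strip_def s'_def)
    have "g' x < g' y" if "x < y" "y \<le> s'" for x y
      using that g_less[of x y] d_less[of "Suc x" "Suc y"] qs by (auto simp: g'_def max_def)
    moreover have "n < g' s'"
      using g d qs by (cases "s \<le> t") (auto simp: g'_def s'_def cut_def rightmost_def)
    ultimately have cut': "cut n s' g'"
      unfolding cut_def using q(1) qs by (auto intro!: strict_mono_onI)
    have v: "strip_degree s' g' v \<le> strip_degree s g v"
    proof (rule strip_degree_le)
      fix w assume w: "w \<in> strip s' g'" "0 < Poly_Mapping.lookup v w"
      obtain r c where rc: "w = (r, c)"
        by (cases w)
      have r: "1 \<le> r" "r \<le> s'" "g' (r - 1) < c" "c < g' r"
        using w(1) by (auto simp: rc strip_def)
      have "0 < Poly_Mapping.lookup u (r, c)"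
        using w(2) by (simp add: u rc lookup_add)
      then have no_gap: "\<not> (d r < c \<and> c < d (Suc r))"
        using d r qs by (auto simp: rightmost_def)
      have hit: "d q < g q"
        using q(3) by (simp add: strip_def)
      consider "r < q" | "r = q" | "q < r"
        by linarith
      then have "g (r - 1) < c \<and> c < g r"
      proof cases
        case 1
        then have "r - 1 < q"
          by linarith
        then show ?thesis
          using r 1 by (simp add: g'_def)
      next
        case 2
        then have "r - 1 < q"
          using r(1) by linarith
        then have "g (r - 1) < c" "c < max (g r) (d (Suc r))"
          using r 2 by (simp_all add: g'_def)
        then show ?thesis
          using no_gap hit 2 by (auto simp: max_def split: if_splits)
      next
        case 3
        then have "\<not> r - 1 < q" "Suc (r - 1) = r"
          by linarith+
        then have "max (g (r - 1)) (d r) < c" "c < max (g r) (d (Suc r))"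
          using r 3 by (simp_all add: g'_def)
        then show ?thesis
          using no_gap by (auto simp: max_def split: if_splits)
      qed
      then show "w \<in> strip s g"
        using r qs by (simp add: rc strip_def)
    qed
    have "Poly_Mapping.keys ?D \<inter> strip s' g' \<subseteq> {(q, d q)}"
    proof (rule subrelI)
      fix r c assume rc: "(r, c) \<in> Poly_Mapping.keys ?D \<inter> strip s' g'"
      then have r: "1 \<le> r" "r \<le> t" "c = d r"
        using D[of r c] by blast+
      then have r': "r \<le> s'" "g' (r - 1) < d r" "d r < g' r"
        using rc by (simp_all add: strip_def)
      have "\<not> q < r"
      proof
        assume "q < r"
        then have "\<not> r - 1 < q" "Suc (r - 1) = r"
          by linarith+
        then show False
          using r'(2) by (simp add: g'_def)
      qed
      moreover have "\<not> r < q"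
      proof
        assume "r < q"
        moreover from this have "r - 1 < q"
          by linarith
        ultimately have "(r, d r) \<in> strip s g"
          using r r' qs by (simp add: g'_def strip_def)
        then show False
          using first \<open>r < q\<close> r(1) by blast
      qed
      ultimately show "(r, c) \<in> {(q, d q)}"
        using r by simp
    qed
    then have "strip_degree s' g' ?D \<le> (\<Sum>w\<in>{(q, d q)}. Poly_Mapping.lookup ?D w)"
      unfolding strip_degree_def by (intro sum_mono2) (simp_all del: upt_Suc)
    then have one: "strip_degree s' g' ?D \<le> 1"
      by (simp add: lookup_diagonal_row_list del: upt_Suc split: if_splits)
    have "g' 0 = g 0"
      using q(1) by (simp add: g'_def)
    then have "pattern_count (S @ [(t, a)]) s' (g 0) \<le> strip_degree s' g' u"
      using cuts cut' unfolding meets_cuts_def by metis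
    then have "pattern_count (S @ [(t, a)]) s' (g 0) \<le> strip_degree s' g' v + 1"
      using one unfolding u strip_degree_add by linarith
    moreover have "pattern_count S s (g 0) + 1 \<le> pattern_count (S @ [(t, a)]) s' (g 0) \<or> pattern_count S s (g 0) = 0"
    proof (cases "g 0 < a")
      case True
      have "filter (\<lambda>(t', a'). s \<le> t' \<and> g 0 < a') S
          = filter (\<lambda>(t', a'). s \<le> t') (filter (\<lambda>(t', a'). s' \<le> t' \<and> g 0 < a') S)"
        unfolding filter_filter using qs by (intro filter_cong) auto
      then have "pattern_count S s (g 0) \<le> pattern_count S s' (g 0)"
        unfolding pattern_count_def by (metis length_filter_le)
      then show ?thesis
        using True qs by (simp add: pattern_count_def)
    next
      case False
      then show ?thesis
        using S by (fastforce simp: pattern_count_def filter_empty_conv)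
    qed
    ultimately show ?thesis
      using v by linarith
  qed
qed

section \<open>The product ideal meets all cuts\<close>

lemma monomials_add: "u \<in> monomials m n \<Longrightarrow> v \<in> monomials m n \<Longrightarrow> u + v \<in> monomials m n"
  unfolding monomials_def using keys_add[of u v] by auto

lemma cring_poly_ring: "cring (poly_ring m n :: 'k::field polynomial ring)"
proof (rule cringI)
  let ?C = "{p :: 'k polynomial. Poly_Mapping.keys p \<subseteq> monomials m n}"
  have add: "p + q \<in> ?C" if "p \<in> ?C" "q \<in> ?C" for p q
    using that keys_add[of p q] by auto
  have mult: "p * q \<in> ?C" if "p \<in> ?C" "q \<in> ?C" for p q
    using that keys_mult[of p q] by (fastforce intro: monomials_add)
  have neg: "- p \<in> ?C" if "p \<in> ?C" for p
    using that by (simp add: subset_iff in_keys_iff)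
  have one: "1 \<in> ?C"
    by (simp add: monomials_def)
  show "abelian_group (poly_ring m n :: 'k polynomial ring)"
  proof (rule abelian_groupI)
    fix p :: "'k polynomial" assume "p \<in> carrier (poly_ring m n)"
    then show "\<exists>q\<in>carrier (poly_ring m n). q \<oplus>\<^bsub>poly_ring m n\<^esub> p = \<zero>\<^bsub>poly_ring m n\<^esub>"
      using neg[of p] by (intro bexI[of _ "- p"]) (simp_all add: poly_ring_def)
  qed (use add in \<open>auto simp: poly_ring_def algebra_simps\<close>)
  show "comm_monoid (poly_ring m n :: 'k polynomial ring)"
    by (rule comm_monoidI) (use mult one in \<open>auto simp: poly_ring_def algebra_simps\<close>)
qed (simp add: poly_ring_def algebra_simps)

lemma poly_ring_simps [simp]:
  "p \<in> carrier (poly_ring m n) \<longleftrightarrow> Poly_Mapping.keys p \<subseteq> monomials m n"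
  "p \<otimes>\<^bsub>poly_ring m n\<^esub> q = p * q" "p \<oplus>\<^bsub>poly_ring m n\<^esub> q = p + q"
  "\<one>\<^bsub>poly_ring m n\<^esub> = 1" "\<zero>\<^bsub>poly_ring m n\<^esub> = 0"
  by (simp_all add: poly_ring_def)

lemma minor_in_carrier:
  assumes cs: "cs \<in> columns n t a" and "1 \<le> a" "t \<le> m"
  shows "minor cs \<in> carrier (poly_ring m n)"
proof -
  have "u \<in> monomials m n" if u: "u \<in> Poly_Mapping.keys (minor cs :: 'k::field polynomial)" for u
  proof -
    let ?u = "\<lambda>p. diagonal (map (\<lambda>i. cs ! p i) [0..<length cs])"
    obtain p where p: "p permutes {0..<length cs}" "u \<in> Poly_Mapping.keys (Poly_Mapping.single (?u p) (signof p :: 'k))"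
      using u keys_sum[of "\<lambda>p. Poly_Mapping.single (?u p) (signof p :: 'k)"]
      unfolding minor_expansion by blast
    then have u_eq: "u = ?u p"
      using keys_single[of "?u p" "signof p :: 'k"] by (metis (full_types) empty_iff singletonD)
    have "(r, c) \<in> {1..m} \<times> {1..n}" if "(r, c) \<in> Poly_Mapping.keys u" for r c
    proof -
      have r: "1 \<le> r" "r \<le> length cs" and c: "c = map (\<lambda>i. cs ! p i) [0..<length cs] ! (r - 1)"
        using that unfolding u_eq in_keys_iff lookup_diagonal by (auto split: if_splits)
      have "r - 1 < length cs"
        using r by linarith
      then have "p (r - 1) < length cs" "c = cs ! p (r - 1)"
        using permutes_in_image[OF p(1), of "r - 1"] c by simp_all
      then have "c \<in> {a..n}"
        using cs nth_mem by (fastforce simp: columns_def)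
      then show ?thesis
        using r assms by (simp add: columns_def)
    qed
    then show ?thesis
      by (auto simp: monomials_def)
  qed
  then show ?thesis
    by auto
qed

lemma dvd_ideal:
  fixes \<phi> :: "'k::field polynomial \<Rightarrow> 'b::comm_ring_1"
  assumes "comm_ring_hom \<phi>"
  shows "ideal {p \<in> carrier (poly_ring m n). e dvd \<phi> p} (poly_ring m n)"
proof -
  interpret \<phi>: comm_ring_hom \<phi> by fact
  interpret R: cring "poly_ring m n :: 'k polynomial ring" by (rule cring_poly_ring)
  have inv: "\<ominus>\<^bsub>poly_ring m n\<^esub> p = - p" if "p \<in> carrier (poly_ring m n)" for p :: "'k polynomial"
    by (rule R.minus_equality) (use that in \<open>simp_all add: subset_iff in_keys_iff\<close>)
  show ?thesis
  proof (rule idealI)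
    show "ring (poly_ring m n :: 'k polynomial ring)"
      by (rule R.ring_axioms)
    show "subgroup {p \<in> carrier (poly_ring m n). e dvd \<phi> p} (add_monoid (poly_ring m n))"
    proof (rule R.add.subgroupI)
      fix p assume p: "p \<in> {p \<in> carrier (poly_ring m n). e dvd \<phi> p}"
      then have "\<ominus>\<^bsub>poly_ring m n\<^esub> p \<in> carrier (poly_ring m n)"
        by (intro R.a_inv_closed) blast
      moreover have "\<phi> (- p) = - \<phi> p"
        using \<phi>.hom_add[of p "- p"] by (simp add: eq_neg_iff_add_eq_0 add.commute)
      ultimately show "\<ominus>\<^bsub>poly_ring m n\<^esub> p \<in> {p \<in> carrier (poly_ring m n). e dvd \<phi> p}"
        using p inv[of p] by (simp del: poly_ring_simps)
    next
      fix p q :: "'k polynomial"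
      assume "p \<in> {p \<in> carrier (poly_ring m n). e dvd \<phi> p}" "q \<in> {p \<in> carrier (poly_ring m n). e dvd \<phi> p}"
      then show "p \<oplus>\<^bsub>poly_ring m n\<^esub> q \<in> {p \<in> carrier (poly_ring m n). e dvd \<phi> p}"
        using R.a_closed[of p q] by (simp add: \<phi>.hom_add)
    qed (auto intro!: exI[of _ 0])
  next
    fix p q :: "'k polynomial"
    assume "p \<in> {p \<in> carrier (poly_ring m n). e dvd \<phi> p}" "q \<in> carrier (poly_ring m n)"
    then show "q \<otimes>\<^bsub>poly_ring m n\<^esub> p \<in> {p \<in> carrier (poly_ring m n). e dvd \<phi> p}"
        "p \<otimes>\<^bsub>poly_ring m n\<^esub> q \<in> {p \<in> carrier (poly_ring m n). e dvd \<phi> p}"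
      using R.m_closed[of p q] R.m_closed[of q p] by (simp_all add: \<phi>.hom_mult)
  qed
qed

definition pattern_bounded :: "nat \<Rightarrow> nat \<Rightarrow> (nat \<times> nat) list \<Rightarrow> bool" where
  "pattern_bounded m n S \<longleftrightarrow> (\<forall>(t, a)\<in>set S. 1 \<le> a \<and> t \<le> m)"

lemma minors_in_carrier:
  "1 \<le> a \<Longrightarrow> t \<le> m \<Longrightarrow> minors n t a \<subseteq> carrier (poly_ring m n)"
  unfolding minors_def using minor_in_carrier by blast

lemma pattern_ideal_Cons:
  "pattern_ideal m n (p # S) = ideal_prod (poly_ring m n) (ne_ideal m n p) (pattern_ideal m n S)"
  by (simp add: pattern_ideal_def)

lemma ideal_pattern_ideal:
  assumes "pattern_bounded m n S"
  shows "ideal (pattern_ideal m n S :: 'k::field polynomial set) (poly_ring m n)"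
  using assms
proof (induction S)
  case Nil
  interpret R: cring "poly_ring m n :: 'k polynomial ring" by (rule cring_poly_ring)
  show ?case
    by (simp add: pattern_ideal_def R.oneideal)
next
  case (Cons p S)
  interpret R: cring "poly_ring m n :: 'k polynomial ring" by (rule cring_poly_ring)
  obtain t a where p: "p = (t, a)"
    by (cases p)
  have "minors n t a \<subseteq> carrier (poly_ring m n :: 'k polynomial ring)"
    using Cons.prems by (intro minors_in_carrier) (auto simp: p pattern_bounded_def)
  then have "ideal (ne_ideal m n p :: 'k polynomial set) (poly_ring m n)"
    unfolding p ne_ideal_def prod.case by (rule R.genideal_ideal)
  moreover have "ideal (pattern_ideal m n S :: 'k polynomial set) (poly_ring m n)"
    using Cons by (simp add: pattern_bounded_def)
  ultimately show ?case
    unfolding pattern_ideal_Cons by (rule R.ideal_prod_is_ideal)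
qed

lemma ne_ideal_dvd:
  assumes g: "cut n s g" and "s \<le> t" "g 0 < a" "1 \<le> a" "t \<le> m"
    and p: "p \<in> ne_ideal m n (t, a)"
  shows "eps dvd substitute lconst (degenerate_entry s g) (p :: 'k::field polynomial)"
proof -
  interpret R: cring "poly_ring m n :: 'k polynomial ring" by (rule cring_poly_ring)
  let ?I = "{p \<in> carrier (poly_ring m n). eps dvd substitute lconst (degenerate_entry s g) (p :: 'k polynomial)}"
  have "minors n t a \<subseteq> ?I"
  proof
    fix q :: "'k polynomial" assume "q \<in> minors n t a"
    then obtain cs where cs: "q = minor cs" "cs \<in> columns n t a"
      by (auto simp: minors_def)
    then have "s \<le> length cs" "set cs \<subseteq> {g 0<..n}"
      using assms by (auto simp: columns_def)
    then show "q \<in> ?I"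
      using degenerate_minor[OF g] minor_in_carrier[of cs n t a m] cs assms by blast
  qed
  then have "genideal (poly_ring m n) (minors n t a) \<subseteq> ?I"
    by (rule R.genideal_minimal[OF dvd_ideal[OF substitute_hom[OF lconst_hom]]])
  then show ?thesis
    using p by (auto simp: ne_ideal_def)
qed

text \<open>
  Each factor \<open>I_t(a)\<close> with \<open>s \<le> t\<close> and \<open>g 0 < a\<close> contributes one factor \<open>\<epsilon>\<close>.
\<close>

lemma pattern_ideal_dvd:
  assumes g: "cut n s g" and "pattern_bounded m n S" and "x \<in> pattern_ideal m n S"
  shows "eps ^ pattern_count S s (g 0) dvd substitute lconst (degenerate_entry s g) (x :: 'k::field polynomial)"
  using assms(2,3)
proof (induction S arbitrary: x)
  case Nil
  then show ?case
    by (simp add: pattern_count_def)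
next
  case (Cons p S)
  interpret hom: comm_ring_hom "substitute lconst (degenerate_entry s g) :: 'k polynomial \<Rightarrow> 'k laurent"
    by (rule substitute_hom[OF lconst_hom])
  obtain t a where p: "p = (t, a)"
    by (cases p)
  let ?e = "if s \<le> t \<and> g 0 < a then 1 else 0 :: nat"
  have e: "pattern_count (p # S) s (g 0) = ?e + pattern_count S s (g 0)"
    by (simp add: pattern_count_def p)
  have bound: "1 \<le> a" "t \<le> m" "pattern_bounded m n S"
    using Cons.prems(1) by (auto simp: pattern_bounded_def p)
  from Cons.prems(2) show ?case
    unfolding pattern_ideal_Cons
  proof (induction rule: ideal_prod.induct)
    case (prod i j)
    have "eps ^ ?e dvd substitute lconst (degenerate_entry s g) i"
      using ne_ideal_dvd[OF g _ _ bound(1,2)] prod(1) by (auto simp: p)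
    then show ?case
      using Cons.IH[OF bound(3) prod(2)]
      unfolding e power_add poly_ring_simps hom.hom_mult by (rule mult_dvd_mono)
  next
    case (sum x y)
    then show ?case
      by (simp add: hom.hom_add)
  qed
qed

lemma meets_cuts_in_mon:
  fixes x :: "'k::field polynomial"
  assumes "pattern_bounded m n S" "x \<in> pattern_ideal m n S" "x \<noteq> 0"
  shows "meets_cuts n S (in_mon x)"
  unfolding meets_cuts_def
  using strip_degree_in_mon_ge[OF assms(3)] pattern_ideal_dvd[OF _ assms(1,2)] by blast

section \<open>Canonical tableaux and their initial monomials\<close>

lemma leading_minors:
  assumes "\<delta> \<in> minors n t a"
  shows "leading (\<delta> :: 'k::field polynomial) (in_mon \<delta>) 1"
proof -
  obtain cs where "\<delta> = minor cs" "sorted_wrt (<) cs"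
    using assms by (auto simp: minors_def columns_def)
  then show ?thesis
    using leading_minor[of cs, where 'k = 'k] in_mon_eqI by fastforce
qed

lemma ne_tableau_cases:
  "ne_tableau m n S (M, \<delta>s) \<longleftrightarrow>
    M \<in> monomials m n \<and> list_all2 (\<lambda>(t, a) \<delta>. \<delta> \<in> minors n t a) S \<delta>s"
  by (simp add: ne_tableau_def)

lemma leading_tab_poly:
  assumes "ne_tableau m n S (M, \<delta>s :: 'k::field polynomial list)"
  shows "leading (tab_poly (M, \<delta>s)) (M + (\<Sum>\<delta>\<leftarrow>\<delta>s. in_mon \<delta>)) 1"
proof -
  have "list_all2 (\<lambda>(t, a) \<delta>. \<delta> \<in> minors n t a) S \<delta>s"
    using assms by (simp add: ne_tableau_cases)
  then have "leading (prod_list \<delta>s) (\<Sum>\<delta>\<leftarrow>\<delta>s. in_mon \<delta>) 1"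
  proof (induction rule: list_all2_induct)
    case Nil
    then show ?case
      using leading_single[of 0 1] by simp
  next
    case (Cons p S \<delta> \<delta>s)
    then have "leading \<delta> (in_mon \<delta>) 1"
      using leading_minors by (cases p) auto
    then show ?case
      using leading_mult[OF _ Cons(3)] by fastforce
  qed
  then show ?thesis
    using leading_mult[OF leading_single] by (fastforce simp: tab_poly_def monom_poly_def)
qed

lemma in_mon_tab_poly:
  "ne_tableau m n S (M, \<delta>s) \<Longrightarrow> in_mon (tab_poly (M, \<delta>s)) = M + (\<Sum>\<delta>\<leftarrow>\<delta>s. in_mon \<delta>)"
  by (rule in_mon_eqI[OF leading_tab_poly]) simp_all

lemma canonical_ne_tableau: "canonical m n S T \<Longrightarrow> ne_tableau m n S T"
  by (cases T) (simp add: canonical_def)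

lemma leading_canonical:
  assumes "canonical m n S T"
  shows "leading (tab_poly T) (in_mon (tab_poly T)) 1"
  using leading_tab_poly[of m n S "fst T" "snd T"] in_mon_tab_poly[of m n S "fst T" "snd T"]
    canonical_ne_tableau[OF assms] by simp

text \<open>
  The conditions on the earlier minors do not involve the last one, so canonical tableaux can be
  treated by recursion on the end of the pattern.
\<close>

lemma canonical_snoc:
  "canonical m n (S @ [(t, a)]) (M, \<delta>s @ [\<delta>]) \<longleftrightarrow>
    canonical m n S (M, \<delta>s) \<and> \<delta> \<in> minors n t a \<and>
    in_mon \<delta> \<in> diagonals_of_type n (t, a) (in_mon (tab_poly (M, \<delta>s @ [\<delta>]))) \<and>
    (\<forall>d\<in>diagonals_of_type n (t, a) (in_mon (tab_poly (M, \<delta>s @ [\<delta>]))). in_mon \<delta> \<le> d)"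
  (is "?L \<longleftrightarrow> ?R")
proof (cases "length \<delta>s = length S")
  case True
  then have "ne_tableau m n (S @ [(t, a)]) (M, \<delta>s @ [\<delta>]) \<longleftrightarrow> ne_tableau m n S (M, \<delta>s) \<and> \<delta> \<in> minors n t a"
    by (auto simp: ne_tableau_def list_all2_append)
  then show ?thesis
    using True by (auto simp: canonical_def Let_def less_Suc_eq nth_append take_append)
next
  case False
  then show ?thesis
    by (auto simp: canonical_def ne_tableau_def dest: list_all2_lengthD)
qed

text \<open>
  The greedy diagonal for the last entry of the pattern is the initial monomial of the last minor; what
  remains of \<open>u\<close> still meets all cuts for the shorter pattern.
\<close>

lemma canonical_tableau_exists:
  assumes "ne_pattern m n S" "meets_cuts n S u" "u \<in> monomials m n"
  shows "\<exists>T :: 'k::field tableau. canonical m n S T \<and> in_mon (tab_poly T) = u"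
  using assms
proof (induction S arbitrary: u rule: rev_induct)
  case Nil
  have "canonical m n [] (u, [] :: 'k polynomial list)"
    using Nil by (simp add: canonical_def ne_tableau_def)
  moreover from this have "in_mon (tab_poly (u, [] :: 'k polynomial list)) = u"
    using in_mon_tab_poly[OF canonical_ne_tableau] by fastforce
  ultimately show ?case
    by blast
next
  case (snoc p S)
  obtain t a where p: "p = (t, a)"
    by (cases p)
  have S: "ne_pattern m n S" "\<And>t' a'. (t', a') \<in> set S \<Longrightarrow> a' \<le> a"
    and ta: "1 \<le> t" "1 \<le> a" "t + a \<le> n + 1"
    using snoc.prems(1) by (auto simp: ne_pattern_def p sorted_wrt_append)
  have "0 < strip_degree t g u" if "cut n t g" "g 0 < a" for g
  proof -
    have "pattern_count (S @ [p]) t (g 0) \<le> strip_degree t g u"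
      using snoc.prems(2) that(1) by (simp add: meets_cuts_def)
    then show ?thesis
      using that(2) by (simp add: pattern_count_def p)
  qed
  then obtain d where d: "rightmost n t d u" "a \<le> d 1"
    using exists_rightmost[OF ta(2,1,3)] by blast
  define cs where "cs = row_list t d"
  have len: "length cs = t"
    by (simp add: cs_def)
  have d_less: "d x < d y" if "1 \<le> x" "x < y" "y \<le> Suc t" for x y
    using d(1) strict_mono_onD[of "{1..Suc t}" d x y] that by (auto simp: rightmost_def)
  have nth: "cs ! k = d (Suc k)" if "k < t" for k
    using that by (simp add: cs_def del: upt_Suc)
  have "cs ! k \<in> {a..n}" if "k < t" for k
    using that d(2) d_less[of 1 "Suc k"] d_less[of "Suc k" "Suc t"] d(1)
    by (cases k) (auto simp: nth rightmost_def)
  then have cs: "cs \<in> columns n t a"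
    using len by (auto simp: columns_def sorted_wrt_iff_nth_less nth d_less in_set_conv_nth)
  have "\<forall>k<length cs. 0 < Poly_Mapping.lookup u (Suc k, cs ! k)"
    using d(1) by (auto simp: len nth rightmost_def)
  then obtain v where v: "u = diagonal cs + v"
    unfolding diagonal_divides_iff[symmetric] by blast
  have "Poly_Mapping.keys v \<subseteq> Poly_Mapping.keys u"
    by (auto simp: v in_keys_iff lookup_add)
  then have "v \<in> monomials m n"
    using snoc.prems(3) by (auto simp: monomials_def)
  moreover have "meets_cuts n S v"
  proof (rule remove_rightmost)
    show "\<And>t' a'. (t', a') \<in> set S \<Longrightarrow> a' \<le> a"
      by (rule S(2))
    show "meets_cuts n (S @ [(t, a)]) u"
      using snoc.prems(2) by (simp add: p)
    show "1 \<le> t" "rightmost n t d u"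
      by fact+
    show "u = diagonal (row_list t d) + v"
      using v by (simp only: cs_def)
  qed
  ultimately obtain T :: "'k tableau" where T: "canonical m n S T" "in_mon (tab_poly T) = v"
    using snoc.IH S(1) by blast
  obtain M \<delta>s where M: "T = (M, \<delta>s)"
    by (cases T)
  let ?\<delta> = "minor cs :: 'k polynomial"
  have \<delta>: "?\<delta> \<in> minors n t a"
    using cs by (simp add: minors_def)
  have in_\<delta>: "in_mon ?\<delta> = diagonal cs"
    using cs by (intro in_mon_eqI[OF leading_minor]) (auto simp: columns_def)
  have "ne_tableau m n S (M, \<delta>s)"
    using canonical_ne_tableau[OF T(1)] by (simp add: M)
  then have "ne_tableau m n (S @ [(t, a)]) (M, \<delta>s @ [?\<delta>])"
    using \<delta> by (auto simp: ne_tableau_def intro!: list_all2_appendI)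
  then have "in_mon (tab_poly (M, \<delta>s @ [?\<delta>])) = (M + (\<Sum>\<delta>\<leftarrow>\<delta>s. in_mon \<delta>)) + diagonal cs"
    by (subst in_mon_tab_poly) (simp_all add: in_\<delta> ac_simps)
  moreover have "M + (\<Sum>\<delta>\<leftarrow>\<delta>s. in_mon \<delta>) = v"
    using T(2) in_mon_tab_poly[OF \<open>ne_tableau m n S (M, \<delta>s)\<close>] by (simp add: M)
  ultimately have in_u: "in_mon (tab_poly (M, \<delta>s @ [?\<delta>])) = u"
    by (simp add: v add.commute)
  have "diagonal cs \<le> diagonal cs'" if "cs' \<in> columns n t a" "\<exists>r. u = diagonal cs' + r" for cs'
    using rightmost_least[OF d(1) that] by (simp add: cs_def)
  then have "canonical m n (S @ [(t, a)]) (M, \<delta>s @ [?\<delta>])"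
    unfolding canonical_snoc in_u in_\<delta> using T(1) \<delta> cs v
    by (auto simp: M diagonals_of_type_def)
  then show ?case
    using in_u unfolding p by blast
qed

text \<open>
  The initial monomial determines its least diagonal of the last type, hence the last minor, and
  then the initial monomial of the rest.
\<close>

lemma canonical_unique:
  assumes "canonical m n S T" "canonical m n S T'"
    and "in_mon (tab_poly T) = in_mon (tab_poly (T' :: 'k::field tableau))"
  shows "T = T'"
  using assms
proof (induction S arbitrary: T T' rule: rev_induct)
  case Nil
  obtain M \<delta>s M' \<delta>s' where T: "T = (M, \<delta>s)" "T' = (M', \<delta>s')"
    by (cases T, cases T')
  have "\<delta>s = []" "\<delta>s' = []"
    using canonical_ne_tableau[OF Nil(1)] canonical_ne_tableau[OF Nil(2)]
    by (simp_all add: T ne_tableau_def)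
  then show ?case
    using Nil(3) in_mon_tab_poly[of m n "[]" M \<delta>s] in_mon_tab_poly[of m n "[]" M' \<delta>s']
      canonical_ne_tableau[OF Nil(1)] canonical_ne_tableau[OF Nil(2)] by (simp add: T)
next
  case (snoc p S)
  obtain t a where p: "p = (t, a)"
    by (cases p)
  have decomp: "\<exists>M \<delta>s \<delta>. X = (M, \<delta>s @ [\<delta>])" if "canonical m n (S @ [p]) X" for X :: "'k tableau"
    using canonical_ne_tableau[OF that]
    by (cases X; cases "snd X" rule: rev_cases) (auto simp: ne_tableau_def dest: list_all2_lengthD)
  obtain M \<delta>s \<delta> where T: "T = (M, \<delta>s @ [\<delta>])"
    using decomp snoc.prems(1) by blast
  obtain M' \<delta>s' \<delta>' where T': "T' = (M', \<delta>s' @ [\<delta>'])"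
    using decomp snoc.prems(2) by blast
  have can: "canonical m n S (M, \<delta>s)" "\<delta> \<in> minors n t a"
    and can': "canonical m n S (M', \<delta>s')" "\<delta>' \<in> minors n t a"
    using snoc.prems(1,2) unfolding T T' p canonical_snoc by blast+
  have "in_mon \<delta> = in_mon \<delta>'"
    using snoc.prems unfolding T T' p canonical_snoc by (metis order.antisym)
  moreover obtain cs cs' where cs: "\<delta> = minor cs" "cs \<in> columns n t a" "\<delta>' = minor cs'" "cs' \<in> columns n t a"
    using can(2) can'(2) by (auto simp: minors_def)
  moreover have "in_mon (minor ds :: 'k polynomial) = diagonal ds" if "ds \<in> columns n t a" for ds
    using that by (intro in_mon_eqI[OF leading_minor]) (auto simp: columns_def)
  ultimately have "diagonal cs = diagonal cs'"
    by simp
  then have "cs = cs'"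
    using cs by (intro diagonal_inject) (auto simp: columns_def)
  then have \<delta>: "\<delta> = \<delta>'"
    by (simp add: cs)
  have "in_mon (tab_poly (M, \<delta>s)) + in_mon \<delta> = in_mon (tab_poly T)"
    using in_mon_tab_poly[OF canonical_ne_tableau[OF can(1)]]
      in_mon_tab_poly[OF canonical_ne_tableau[OF snoc.prems(1)[unfolded T]]]
    by (simp add: T ac_simps)
  moreover have "in_mon (tab_poly (M', \<delta>s')) + in_mon \<delta>' = in_mon (tab_poly T')"
    using in_mon_tab_poly[OF canonical_ne_tableau[OF can'(1)]]
      in_mon_tab_poly[OF canonical_ne_tableau[OF snoc.prems(2)[unfolded T']]]
    by (simp add: T' ac_simps)
  ultimately have "in_mon (tab_poly (M, \<delta>s)) = in_mon (tab_poly (M', \<delta>s'))"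
    using snoc.prems(3) \<delta> by (metis add_right_cancel)
  then show ?case
    using snoc.IH[OF can(1) can'(1)] \<delta> by (simp add: T T')
qed

lemma tab_poly_in_pattern_ideal:
  assumes "pattern_bounded m n S" "ne_tableau m n S T"
  shows "tab_poly T \<in> (pattern_ideal m n S :: 'k::field polynomial set)"
proof -
  interpret R: cring "poly_ring m n :: 'k polynomial ring" by (rule cring_poly_ring)
  interpret I: ideal "pattern_ideal m n S :: 'k polynomial set" "poly_ring m n"
    by (rule ideal_pattern_ideal[OF assms(1)])
  obtain M \<delta>s where T: "T = (M, \<delta>s)"
    by (cases T)
  have "list_all2 (\<lambda>(t, a) \<delta>. \<delta> \<in> minors n t a) S \<delta>s"
    using assms(2) by (simp add: T ne_tableau_def)
  then have "prod_list \<delta>s \<in> pattern_ideal m n S"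
    using assms(1)
  proof (induction rule: list_all2_induct)
    case Nil
    then show ?case
      using R.one_closed by (simp add: pattern_ideal_def)
  next
    case (Cons p S \<delta> \<delta>s)
    obtain t a where p: "p = (t, a)"
      by (cases p)
    have "\<delta> \<in> ne_ideal m n p"
      using Cons.hyps(1) Cons.prems R.genideal_self[OF minors_in_carrier[of a t m n]]
      by (auto simp: p ne_ideal_def pattern_bounded_def)
    moreover have "prod_list \<delta>s \<in> pattern_ideal m n S"
      using Cons by (simp add: pattern_bounded_def)
    ultimately show ?case
      using ideal_prod.prod[of \<delta> "ne_ideal m n p" "prod_list \<delta>s" "pattern_ideal m n S" "poly_ring m n"]
      by (simp add: pattern_ideal_Cons)
  qed
  moreover have "monom_poly M \<in> carrier (poly_ring m n :: 'k polynomial ring)"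
    using assms(2) by (simp add: T ne_tableau_def monom_poly_def)
  ultimately show ?thesis
    using I.I_l_closed by (fastforce simp: T tab_poly_def)
qed

section \<open>Expansion in canonical tableaux\<close>

text \<open>
  The lexicographic order is well-founded on monomials in finitely many indeterminates. The argument
  minimises the exponent of the largest indeterminate first and recurses on the minimisers.
\<close>

lemma lex_least_exists:
  fixes Q :: "('a::linorder \<Rightarrow>\<^sub>0 nat) set"
  assumes "finite A" "Q \<noteq> {}"
    and "\<And>u v k. u \<in> Q \<Longrightarrow> v \<in> Q \<Longrightarrow> k \<notin> A \<Longrightarrow> Poly_Mapping.lookup u k = Poly_Mapping.lookup v k"
  shows "\<exists>u\<in>Q. \<forall>v\<in>Q. u \<le> v"
  using assms
proof (induction A arbitrary: Q rule: finite_linorder_min_induct)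
  case empty
  then obtain u where u: "u \<in> Q"
    by blast
  have "v = u" if "v \<in> Q" for v
    using empty(2)[OF that u] by (intro poly_mapping_eqI) simp
  then show ?case
    using u by blast
next
  case (insert b A)
  define l where "l = (LEAST l. \<exists>u\<in>Q. Poly_Mapping.lookup u b = l)"
  define Q' where "Q' = {u \<in> Q. Poly_Mapping.lookup u b = l}"
  have "\<exists>u\<in>Q. Poly_Mapping.lookup u b = l"
    unfolding l_def by (rule LeastI_ex) (use insert.prems(1) in blast)
  then have "Q' \<noteq> {}"
    by (auto simp: Q'_def)
  moreover have "Poly_Mapping.lookup u k = Poly_Mapping.lookup v k"
    if "u \<in> Q'" "v \<in> Q'" "k \<notin> A" for u v k
    using that insert.prems(2)[of u v k] by (cases "k = b") (auto simp: Q'_def)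
  ultimately obtain u where u: "u \<in> Q'" "\<And>v. v \<in> Q' \<Longrightarrow> u \<le> v"
    using insert.IH[of Q'] by blast
  have "u \<le> v" if v: "v \<in> Q" for v
  proof (cases "v \<in> Q'")
    case False
    have "l \<le> Poly_Mapping.lookup v b"
      unfolding l_def using v by (intro Least_le) blast
    then have "Poly_Mapping.lookup u b < Poly_Mapping.lookup v b"
      using False v u(1) by (simp add: Q'_def)
    moreover have "Poly_Mapping.lookup u k = Poly_Mapping.lookup v k" if "k < b" for k
    proof -
      have "k \<notin> insert b A"
        using insert.hyps(2) that by auto
      then show ?thesis
        using insert.prems(2)[of u v k] u(1) v by (simp add: Q'_def)
    qed
    ultimately have "u < v"
      unfolding poly_mapping_less_iff by blast
    then show ?thesis
      by simp
  qed (use u in blast)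
  then show ?case
    using u(1) by (auto simp: Q'_def)
qed

abbreviation expand :: "('k::field \<times> 'k tableau) list \<Rightarrow> 'k polynomial" where
  "expand ts \<equiv> (\<Sum>(c, T)\<leftarrow>ts. const_poly c * tab_poly T)"

definition canonical_expansion :: "nat \<Rightarrow> nat \<Rightarrow> (nat \<times> nat) list \<Rightarrow> ('k::field \<times> 'k tableau) list \<Rightarrow> bool" where
  "canonical_expansion m n S ts \<longleftrightarrow>
    (\<forall>(c, T)\<in>set ts. c \<noteq> 0 \<and> canonical m n S T) \<and>
    sorted_wrt (\<lambda>T T'. in_mon (tab_poly T) > in_mon (tab_poly T')) (map snd ts)"

lemma canonical_expansion_Cons:
  "canonical_expansion m n S ((c, T) # ts) \<longleftrightarrow>
    c \<noteq> 0 \<and> canonical m n S T \<and> canonical_expansion m n S ts \<and>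
    (\<forall>(c', T')\<in>set ts. in_mon (tab_poly T') < in_mon (tab_poly T))"
  by (auto simp: canonical_expansion_def)

lemma leading_scaled_canonical:
  "canonical m n S T \<Longrightarrow> leading (const_poly c * tab_poly T) (in_mon (tab_poly T)) c"
  using leading_mult[OF leading_single[of 0 c] leading_canonical] by (simp add: const_poly_def)

lemma leading_expand:
  assumes "canonical_expansion m n S ((c, T) # ts)"
  shows "leading (expand ((c, T) # ts)) (in_mon (tab_poly T)) c"
  using assms
proof (induction ts arbitrary: c T)
  case Nil
  then show ?case
    by (auto simp: canonical_expansion_Cons intro: leading_scaled_canonical)
next
  case (Cons p ts)
  obtain c' T' where p: "p = (c', T')"
    by (cases p)
  have "leading (expand ((c', T') # ts)) (in_mon (tab_poly T')) c'"
    using Cons by (simp add: p canonical_expansion_Cons)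
  then have "w < in_mon (tab_poly T)" if "w \<in> Poly_Mapping.keys (expand ((c', T') # ts))" for w
    using leading_keys_le that Cons.prems by (fastforce simp: p canonical_expansion_Cons)
  then show ?case
    using leading_add_lower[OF leading_scaled_canonical[of m n S T c]] Cons.prems
    by (simp add: p canonical_expansion_Cons)
qed

text \<open>
  The first tableau and its coefficient are the initial term of the sum.
\<close>

lemma expansion_unique:
  assumes "canonical_expansion m n S ts" "canonical_expansion m n S ts'" "expand ts = expand ts'"
  shows "ts = ts'"
  using assms
proof (induction ts arbitrary: ts')
  case Nil
  show ?case
  proof (cases ts')
    case (Cons p us)
    then show ?thesis
      using leading_lookup[OF leading_expand[of m n S "fst p" "snd p" us]] Nil
      by (simp add: canonical_expansion_def split: prod.splits)
  qed simp
next
  case (Cons p ts)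
  obtain c T where p: "p = (c, T)"
    by (cases p)
  have lead: "leading (expand ts') (in_mon (tab_poly T)) c" and "c \<noteq> 0"
    using leading_expand[of m n S c T ts] Cons.prems unfolding p Cons.prems(3)[symmetric]
    by (simp_all add: canonical_expansion_Cons)
  then obtain c' T' us where ts': "ts' = (c', T') # us"
    using leading_lookup[OF lead] by (cases ts') auto
  have lead': "leading (expand ts') (in_mon (tab_poly T')) c'" "c' \<noteq> 0"
    using leading_expand[of m n S c' T' us] Cons.prems(2)
    by (simp_all add: ts' canonical_expansion_Cons)
  have "in_mon (tab_poly T) = in_mon (tab_poly T')" "c = c'"
    using leading_unique[OF lead lead'(1) \<open>c \<noteq> 0\<close> lead'(2)] by simp_all
  moreover from this have "T = T'"
    using Cons.prems canonical_unique[of m n S T T'] by (simp add: p ts' canonical_expansion_Cons)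
  ultimately show ?case
    using Cons.IH[of us] Cons.prems by (simp add: p ts' canonical_expansion_Cons)
qed

text \<open>
  Subtracting a multiple of the canonical tableau with the same initial monomial lowers the initial
  monomial and stays in the ideal; a counterexample with least initial monomial is thus impossible.
\<close>

lemma expansion_exists:
  fixes x :: "'k::field polynomial"
  assumes S: "ne_pattern m n S" and "x \<in> pattern_ideal m n S"
  shows "\<exists>ts. canonical_expansion m n S ts \<and> x = expand ts"
proof (rule ccontr)
  let ?I = "pattern_ideal m n S :: 'k polynomial set"
  have bounded: "pattern_bounded m n S"
    using S by (auto simp: ne_pattern_def pattern_bounded_def)
  interpret I: ideal ?I "poly_ring m n"
    by (rule ideal_pattern_ideal[OF bounded])
  define bad where "bad = {y \<in> ?I. \<nexists>ts. canonical_expansion m n S ts \<and> y = expand ts}"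
  assume "\<nexists>ts. canonical_expansion m n S ts \<and> x = expand ts"
  then have "x \<in> bad"
    using assms(2) by (simp add: bad_def)
  have bad_nz: "y \<noteq> 0" if "y \<in> bad" for y
    using that unfolding bad_def
    by (auto simp: canonical_expansion_def dest!: spec[of _ "[]"])
  have in_mon: "in_mon y \<in> monomials m n" if "y \<in> bad" for y
  proof -
    have "y \<in> carrier (poly_ring m n)"
      using that I.Icarr by (auto simp: bad_def)
    moreover have "in_mon y \<in> Poly_Mapping.keys y"
      using leading_in_mon(2)[OF bad_nz[OF that]] by (simp add: in_keys_iff)
    ultimately show ?thesis
      by auto
  qed
  have "\<exists>u\<in>in_mon ` bad. \<forall>v\<in>in_mon ` bad. u \<le> v"
  proof (rule lex_least_exists)
    show "in_mon ` bad \<noteq> {}"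
      using \<open>x \<in> bad\<close> by blast
    fix u v :: monomial and k
    assume "u \<in> in_mon ` bad" "v \<in> in_mon ` bad" "k \<notin> {1..m} \<times> {1..n}"
    then have "k \<notin> Poly_Mapping.keys u" "k \<notin> Poly_Mapping.keys v"
      using in_mon unfolding monomials_def by blast+
    then show "Poly_Mapping.lookup u k = Poly_Mapping.lookup v k"
      by (simp add: in_keys_iff)
  qed simp
  then obtain y where y: "y \<in> bad" "\<And>z. z \<in> bad \<Longrightarrow> in_mon y \<le> in_mon z"
    by blast
  have "y \<in> ?I"
    using y(1) by (simp add: bad_def)
  obtain T :: "'k tableau" where T: "canonical m n S T" "in_mon (tab_poly T) = in_mon y"
    using canonical_tableau_exists[OF S meets_cuts_in_mon[OF bounded \<open>y \<in> ?I\<close> bad_nz[OF y(1)]] in_mon[OF y(1)]]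
    by blast
  define c where "c = Poly_Mapping.lookup y (in_mon y)"
  have c: "leading y (in_mon y) c" "c \<noteq> 0"
    using leading_in_mon[OF bad_nz[OF y(1)]] by (simp_all add: c_def)
  define z where "z = y - const_poly c * tab_poly T"
  have lower: "w < in_mon y" if "w \<in> Poly_Mapping.keys z" for w
    using leading_cancel[OF c(1) leading_scaled_canonical[OF T(1), of c, unfolded T(2)]] that
    by (simp add: z_def)
  have "const_poly (- c) \<in> carrier (poly_ring m n :: 'k polynomial ring)"
    by (simp add: const_poly_def monomials_def)
  then have "const_poly (- c) * tab_poly T \<in> ?I"
    using I.I_l_closed[OF tab_poly_in_pattern_ideal[OF bounded canonical_ne_tableau[OF T(1)]]] by simp
  moreover have "z = y + const_poly (- c) * tab_poly T"
    by (simp add: z_def const_poly_def single_uminus)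
  ultimately have "z \<in> ?I"
    using additive_subgroup.a_closed[OF I.additive_subgroup_axioms \<open>y \<in> ?I\<close>] by simp
  have "z \<notin> bad"
  proof
    assume z: "z \<in> bad"
    then have "in_mon z < in_mon y"
      using leading_in_mon(2)[OF bad_nz[OF z]] by (intro lower) (simp add: in_keys_iff)
    then show False
      using y(2)[OF z] by simp
  qed
  then obtain ts where ts: "canonical_expansion m n S ts" "z = expand ts"
    using \<open>z \<in> ?I\<close> by (auto simp: bad_def)
  have "in_mon (tab_poly T') < in_mon (tab_poly T)" if T': "(c', T') \<in> set ts" for c' T'
  proof -
    obtain c0 T0 us where ts0: "ts = (c0, T0) # us"
      using T' by (cases ts) auto
    have "in_mon (tab_poly T') \<le> in_mon (tab_poly T0)"
      using T' ts(1) by (auto simp: ts0 canonical_expansion_Cons)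
    moreover have "in_mon (tab_poly T0) \<in> Poly_Mapping.keys z"
      using leading_lookup[OF leading_expand[OF ts(1)[unfolded ts0]]] ts(1)
      by (simp add: ts(2) ts0 in_keys_iff canonical_expansion_Cons)
    ultimately show ?thesis
      using lower T(2) by fastforce
  qed
  then have "canonical_expansion m n S ((c, T) # ts)"
    using ts(1) T(1) c(2) by (auto simp: canonical_expansion_Cons)
  moreover have "y = expand ((c, T) # ts)"
    by (simp add: ts(2)[symmetric] z_def)
  ultimately show False
    using y(1) unfolding bad_def by blast
qed

theorem theorem4p2:
  fixes m n :: nat and S :: "(nat \<times> nat) list" and x :: "'k::field polynomial"
  assumes "ne_pattern m n S"
    and "x \<in> pattern_ideal m n S"
    and "x \<noteq> 0"
  shows "\<exists>!ts :: ('k \<times> 'k tableau) list.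
    ts \<noteq> [] \<and>
    (\<forall>(c, T)\<in>set ts. c \<noteq> 0 \<and> canonical m n S T) \<and>
    x = (\<Sum>(c, T)\<leftarrow>ts. const_poly c * tab_poly T) \<and>
    in_mon x = in_mon (tab_poly (snd (hd ts))) \<and>
    sorted_wrt (\<lambda>T T'. in_mon (tab_poly T) > in_mon (tab_poly T')) (map snd ts)"
proof -
  obtain ts where ts: "canonical_expansion m n S ts" "x = expand ts"
    using expansion_exists[OF assms(1,2)] by blast
  then obtain c T us where ts_eq: "ts = (c, T) # us"
    using assms(3) by (cases ts) auto
  have "in_mon x = in_mon (tab_poly T)"
    using in_mon_eqI[OF leading_expand[OF ts(1)[unfolded ts_eq]]] ts
    by (simp add: ts_eq canonical_expansion_Cons)
  show ?thesis
  proof (rule ex1I[of _ ts], intro conjI)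
    show "ts \<noteq> []" "in_mon x = in_mon (tab_poly (snd (hd ts)))"
      using \<open>in_mon x = in_mon (tab_poly T)\<close> by (simp_all add: ts_eq)
    show "\<forall>(c, T)\<in>set ts. c \<noteq> 0 \<and> canonical m n S T"
      "sorted_wrt (\<lambda>T T'. in_mon (tab_poly T) > in_mon (tab_poly T')) (map snd ts)"
      using ts(1) by (simp_all add: canonical_expansion_def)
    show "x = expand ts"
      by (rule ts(2))
  next
    fix ts'
    assume "ts' \<noteq> [] \<and>
      (\<forall>(c, T)\<in>set ts'. c \<noteq> 0 \<and> canonical m n S T) \<and>
      x = expand ts' \<and>
      in_mon x = in_mon (tab_poly (snd (hd ts'))) \<and>
      sorted_wrt (\<lambda>T T'. in_mon (tab_poly T) > in_mon (tab_poly T')) (map snd ts')"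
    then have "canonical_expansion m n S ts'" "x = expand ts'"
      by (simp_all add: canonical_expansion_def)
    then show "ts' = ts"
      using expansion_unique ts by metis
  qed
qed

end
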